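(* The spectrum of the operator $z : H \to H$ is the closed pair of pants: $\sigma(z) = PP_{(a,r_1,r_2)}$.
   Context: Fix real numbers $a, r_1, r_2$ with $r_1, r_2 > 0$, $0<a<1$, $a+r_2<1$ and $r_1+r_2<a$. The closed pair of pants is $$PP_{(a,r_1,r_2)} = \{\zeta\in\mathbb{C} : |\zeta|\le 1,\ |\zeta|\ge r_1,\ |\zeta-a|\ge r_2\}.$$ Define functions $E_n(\zeta)=\zeta^n$ for $n\ge 0$, and $F_n(\zeta)=(\zeta/r_1)^n$, $G_n(\zeta)=((\zeta-a)/r_2)^n$ for $n\le -1$. Let $H$ be the Hilbert space of holomorphic functions on the interior of $PP_{(a,r_1,r_2)}$ of the form $$\varphi=\sum_{n=0}^\infty e_nE_n+\sum_{n=-\infty}^{-1}(f_nF_n+g_nG_n),\qquad \|\varphi\|^2=\sum_{n=0}^\infty|e_n|^2+\sum_{n=-\infty}^{-1}(|f_n|^2+|g_n|^2)<\infty,$$ so that $\{E_n\}_{n\ge0}\cup\{F_n\}_{n\le-1}\cup\{G_n\}_{n\le-1}$ is an orthonormal basis of $H$. The operator $z:H\to H$ is multiplication by the coordinate: $(z\varphi)(\zeta)=\zeta\varphi(\zeta)$. Equivalently, $zE_n=E_{n+1}$ for $n\ge0$; $zF_n=r_1F_{n+1}$ for $n\le-2$, $zF_{-1}=r_1E_0$; $zG_n=r_2G_{n+1}+aG_n$ for $n\le-2$, $zG_{-1}=r_2E_0+aG_{-1}$. *)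

theory Defs
  imports "HOL-Complex_Analysis.Complex_Analysis"
begin

definition pair_of_pants :: "real \<Rightarrow> real \<Rightarrow> real \<Rightarrow> complex set" where
  "pair_of_pants a r1 r2 =
     {\<zeta>. norm \<zeta> \<le> 1 \<and> norm \<zeta> \<ge> r1 \<and> norm (\<zeta> - of_real a) \<ge> r2}"

definition pants_E :: "nat \<Rightarrow> complex \<Rightarrow> complex" where
  "pants_E n \<zeta> = \<zeta> ^ n"

definition pants_F :: "real \<Rightarrow> int \<Rightarrow> complex \<Rightarrow> complex" where
  "pants_F r1 n \<zeta> = (\<zeta> / of_real r1) powi n"

definition pants_G :: "real \<Rightarrow> real \<Rightarrow> int \<Rightarrow> complex \<Rightarrow> complex" where
  "pants_G a r2 n \<zeta> = ((\<zeta> - of_real a) / of_real r2) powi n"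

definition square_summable :: "'i set \<Rightarrow> ('i \<Rightarrow> complex) \<Rightarrow> bool" where
  "square_summable I c \<longleftrightarrow> (\<lambda>n. (norm (c n))\<^sup>2) summable_on I"

text \<open>
  The coefficients \<open>f\<close> and \<open>g\<close> are indexed by the negative integers; their values at
  nonnegative integers are irrelevant.  Square summability of the coefficients makes the
  three series converge absolutely at every interior point of the pair of pants.
\<close>

definition pants_expansion ::
  "real \<Rightarrow> real \<Rightarrow> real \<Rightarrow> (complex \<Rightarrow> complex) \<Rightarrow>
   (nat \<Rightarrow> complex) \<Rightarrow> (int \<Rightarrow> complex) \<Rightarrow> (int \<Rightarrow> complex) \<Rightarrow> bool" where
  "pants_expansion a r1 r2 \<phi> e f g \<longleftrightarrow>
     square_summable UNIV e \<and> square_summable {..-1} f \<and> square_summable {..-1} g \<and>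
     (\<forall>\<zeta> \<in> interior (pair_of_pants a r1 r2).
        \<phi> \<zeta> = (\<Sum>\<^sub>\<infinity>n. e n * pants_E n \<zeta>)
            + (\<Sum>\<^sub>\<infinity>n\<in>{..-1}. f n * pants_F r1 n \<zeta>)
            + (\<Sum>\<^sub>\<infinity>n\<in>{..-1}. g n * pants_G a r2 n \<zeta>))"

text \<open>
  A function on the interior of the pair of pants is represented by its extension by zero
  to the whole plane, so that equality of elements is equality of HOL functions.
\<close>

definition pants_space :: "real \<Rightarrow> real \<Rightarrow> real \<Rightarrow> (complex \<Rightarrow> complex) set" where
  "pants_space a r1 r2 =
     {\<phi>. \<phi> holomorphic_on interior (pair_of_pants a r1 r2) \<and>
         (\<exists>e f g. pants_expansion a r1 r2 \<phi> e f g) \<and>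
         (\<forall>\<zeta>. \<zeta> \<notin> interior (pair_of_pants a r1 r2) \<longrightarrow> \<phi> \<zeta> = 0)}"

text \<open>
  The norm is well defined because the coefficients with the relevant indices are
  determined by \<open>\<phi>\<close> (uniqueness of the Laurent decomposition on a triply connected domain).
\<close>

definition pants_norm :: "real \<Rightarrow> real \<Rightarrow> real \<Rightarrow> (complex \<Rightarrow> complex) \<Rightarrow> real" where
  "pants_norm a r1 r2 \<phi> =
     (THE N. \<exists>e f g. pants_expansion a r1 r2 \<phi> e f g \<and>
        N = sqrt ((\<Sum>\<^sub>\<infinity>n. (norm (e n))\<^sup>2)
                + (\<Sum>\<^sub>\<infinity>n\<in>{..-1}. (norm (f n))\<^sup>2 + (norm (g n))\<^sup>2)))"

definition mult_coord :: "(complex \<Rightarrow> complex) \<Rightarrow> complex \<Rightarrow> complex" where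
  "mult_coord \<phi> = (\<lambda>\<zeta>. \<zeta> * \<phi> \<zeta>)"

text \<open>
  Bounded operators and the spectrum, for a complex vector space \<open>H\<close> of complex-valued functions with
  pointwise linear structure and norm \<open>N\<close>.
\<close>

definition bounded_operator_on ::
  "('x \<Rightarrow> complex) set \<Rightarrow> (('x \<Rightarrow> complex) \<Rightarrow> real) \<Rightarrow>
   (('x \<Rightarrow> complex) \<Rightarrow> 'x \<Rightarrow> complex) \<Rightarrow> bool" where
  "bounded_operator_on H N T \<longleftrightarrow>
     (\<forall>\<phi>\<in>H. T \<phi> \<in> H) \<and>
     (\<forall>\<phi>\<in>H. \<forall>\<psi>\<in>H. T (\<lambda>x. \<phi> x + \<psi> x) = (\<lambda>x. T \<phi> x + T \<psi> x)) \<and>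
     (\<forall>c. \<forall>\<phi>\<in>H. T (\<lambda>x. c * \<phi> x) = (\<lambda>x. c * T \<phi> x)) \<and>
     (\<exists>C. \<forall>\<phi>\<in>H. N (T \<phi>) \<le> C * N \<phi>)"

definition operator_spectrum ::
  "('x \<Rightarrow> complex) set \<Rightarrow> (('x \<Rightarrow> complex) \<Rightarrow> real) \<Rightarrow>
   (('x \<Rightarrow> complex) \<Rightarrow> 'x \<Rightarrow> complex) \<Rightarrow> complex set" where
  "operator_spectrum H N T =
     {l. \<not> (\<exists>R. bounded_operator_on H N R \<and>
              (\<forall>\<phi>\<in>H. R (\<lambda>x. T \<phi> x - l * \<phi> x) = \<phi>) \<and>
              (\<forall>\<phi>\<in>H. (\<lambda>x. T (R \<phi>) x - l * R \<phi> x) = \<phi>))}"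

end

theory Submission
  imports Defs
begin

text \<open>
  An element of \<open>H\<close> is a sum of three Hardy-type pieces: one on the unit disk and one on
  the exterior of each hole, and each is a power series with square summable coefficients in the
  variable \<open>\<zeta>\<close>, \<open>r\<^sub>1/\<zeta>\<close> or \<open>r\<^sub>2/(\<zeta> - a)\<close>.

  If \<open>l\<close> lies outside the pair of pants, it lies in the domain of exactly two of the pieces.
  There, dividing by \<open>\<zeta> - l\<close> leaves a difference quotient plus a multiple of
  \<open>1/(\<zeta> - l)\<close>.  The latter belongs to the third piece, on which division by \<open>\<zeta> - l\<close> is a
  convolution with a convergent geometric sequence.  Both operations are bounded on \<open>\<ell>\<^sup>2\<close>, so
  division by \<open>\<zeta> - l\<close> is a bounded inverse.

  Conversely, the inverse would map the constant 1 to \<open>1/(\<zeta> - l)\<close>.  That is absurd if \<open>l\<close> is an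
  interior point, and for a boundary point \<open>l\<close> the coefficients of this function have constant
  modulus, so they are not square summable.  Uniqueness of the expansion follows by gluing
  the pieces to entire functions that vanish at infinity.
\<close>

subsection \<open>Square summable sequences and their power series\<close>

definition ell2 :: "(nat \<Rightarrow> complex) \<Rightarrow> bool" where
  "ell2 c \<longleftrightarrow> summable (\<lambda>n. (norm (c n))\<^sup>2)"

definition ell2_norm :: "(nat \<Rightarrow> complex) \<Rightarrow> real" where
  "ell2_norm c = sqrt (\<Sum>n. (norm (c n))\<^sup>2)"

definition power_series :: "(nat \<Rightarrow> complex) \<Rightarrow> complex \<Rightarrow> complex" where
  "power_series c w = (\<Sum>n. c n * w ^ n)"

lemma ell2_norm_nonneg: "ell2 c \<Longrightarrow> ell2_norm c \<ge> 0"
  unfolding ell2_norm_def ell2_def by (simp add: suminf_nonneg)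

lemma L2_set_le_ell2_norm: "ell2 c \<Longrightarrow> finite A \<Longrightarrow> L2_set (\<lambda>n. norm (c n)) A \<le> ell2_norm c"
  unfolding ell2_norm_def ell2_def L2_set_def
  by (intro real_sqrt_le_mono sum_le_suminf) auto

lemma norm_le_ell2_norm: "ell2 c \<Longrightarrow> norm (c n) \<le> ell2_norm c"
  using L2_set_le_ell2_norm[of c "{n}"] by simp

lemma ell2_imp_Bseq: "ell2 c \<Longrightarrow> Bseq c"
  using norm_le_ell2_norm by (metis BseqI')

text \<open>Membership and norm bound together reduce to a bound on initial segments that is uniform
  in their length. Estimates can therefore be made on finite sums, where Minkowski's inequality for
  \<open>L2_set\<close> applies.\<close>

lemma ell2_bound:
  assumes "\<And>N. L2_set (\<lambda>n. norm (c n)) {..<N} \<le> K"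
  shows "ell2 c" "ell2_norm c \<le> K"
proof -
  have K: "0 \<le> K" using assms[of 0] by simp
  have *: "(\<Sum>n<N. (norm (c n))\<^sup>2) \<le> K\<^sup>2" for N
    using assms[of N] K unfolding L2_set_def by (simp add: sqrt_le_D)
  show s: "ell2 c" unfolding ell2_def
    by (rule summableI_nonneg_bounded[OF _ *]) auto
  have "(\<Sum>n. (norm (c n))\<^sup>2) \<le> K\<^sup>2"
    using s[unfolded ell2_def] * by (intro suminf_le_const) auto
  then show "ell2_norm c \<le> K" unfolding ell2_norm_def
    using K real_le_lsqrt by (simp add: real_le_lsqrt)
qed

lemma ell2_scale:
  assumes "ell2 c"
  shows "ell2 (\<lambda>n. k * c n)" "ell2_norm (\<lambda>n. k * c n) = norm k * ell2_norm c"
  using assms unfolding ell2_def ell2_norm_def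
  by (simp_all add: norm_mult power_mult_distrib suminf_mult real_sqrt_mult)

lemma ell2_add:
  assumes "ell2 c" "ell2 d"
  shows "ell2 (\<lambda>n. c n + d n)" "ell2_norm (\<lambda>n. c n + d n) \<le> ell2_norm c + ell2_norm d"
proof -
  have "L2_set (\<lambda>n. norm (c n + d n)) {..<N} \<le> ell2_norm c + ell2_norm d" for N
  proof -
    have "L2_set (\<lambda>n. norm (c n + d n)) {..<N} \<le> L2_set (\<lambda>n. norm (c n) + norm (d n)) {..<N}"
      by (intro L2_set_mono) (auto intro: norm_triangle_ineq)
    also have "\<dots> \<le> L2_set (\<lambda>n. norm (c n)) {..<N} + L2_set (\<lambda>n. norm (d n)) {..<N}"
      by (rule L2_set_triangle_ineq)
    also have "\<dots> \<le> ell2_norm c + ell2_norm d"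
      using assms by (intro add_mono L2_set_le_ell2_norm) auto
    finally show ?thesis .
  qed
  from ell2_bound[OF this] show "ell2 (\<lambda>n. c n + d n)"
    "ell2_norm (\<lambda>n. c n + d n) \<le> ell2_norm c + ell2_norm d" .
qed

lemma ell2_single: "ell2 (\<lambda>n. if n = 0 then s else 0)" "ell2_norm (\<lambda>n. if n = 0 then s else 0) = norm s"
proof -
  have *: "(\<lambda>n::nat. (norm (if n = 0 then s else 0))\<^sup>2) = (\<lambda>n. if n = 0 then (norm s)\<^sup>2 else 0)" by auto
  have "(\<lambda>n::nat. if n = 0 then (norm s)\<^sup>2 else 0) sums (norm s)\<^sup>2"
    using sums_single[of 0 "\<lambda>_. (norm s)\<^sup>2"] by (simp cong: if_cong)
  then show "ell2 (\<lambda>n. if n = 0 then s else 0)" "ell2_norm (\<lambda>n. if n = 0 then s else 0) = norm s"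
    unfolding ell2_def ell2_norm_def * by (auto simp: sums_iff)
qed

lemma ell2_case_nat_0:
  assumes "ell2 c"
  shows "ell2 (case_nat 0 c)" "ell2_norm (case_nat 0 c) = ell2_norm c"
proof -
  show *: "ell2 (case_nat 0 c)" using assms unfolding ell2_def
    by (subst summable_Suc_iff[symmetric]) simp
  show "ell2_norm (case_nat 0 c) = ell2_norm c"
    using suminf_split_head[OF *[unfolded ell2_def]] unfolding ell2_norm_def by simp
qed

lemma case_nat_split: "case_nat s c = (\<lambda>n. case_nat 0 c n + (if n = 0 then s else (0::complex)))"
  by (auto split: nat.splits)

lemma ell2_case_nat:
  assumes "ell2 c"
  shows "ell2 (case_nat s c)" "ell2_norm (case_nat s c) \<le> ell2_norm c + norm s"
  unfolding case_nat_split[of s c]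
  using ell2_add[OF ell2_case_nat_0(1)[OF assms] ell2_single(1)[of s]]
  by (auto simp: ell2_case_nat_0[OF assms] ell2_single)

section \<open>Power series with bounded coefficients on the unit disk\<close>

lemma summable_power_series:
  fixes c :: "nat \<Rightarrow> complex"
  assumes "Bseq c" "norm w < 1"
  shows "summable (\<lambda>n. norm (c n * w ^ n))"
proof -
  obtain K where K: "\<And>n. norm (c n) \<le> K" using assms(1) by (auto simp: Bseq_def)
  have "summable (\<lambda>n. K * norm w ^ n)" using assms(2) by (intro summable_mult summable_geometric) auto
  then show ?thesis
    by (rule summable_comparison_test[rotated])
       (use K in \<open>auto simp: norm_mult norm_power intro!: exI[of _ 0] mult_right_mono\<close>)
qed

lemma power_series_sums:
  assumes "Bseq c" "norm w < 1"
  shows "(\<lambda>n. c n * w ^ n) sums power_series c w"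
  unfolding power_series_def
  using summable_norm_cancel[OF summable_power_series[OF assms]] by (rule summable_sums)

lemma norm_power_series_le:
  assumes K: "\<And>n. norm (c n) \<le> K" and w: "norm w < 1"
  shows "norm (power_series c w) \<le> K / (1 - norm w)"
proof -
  have B: "Bseq c" using K by (rule BseqI')
  have "norm (power_series c w) \<le> (\<Sum>n. norm (c n * w ^ n))"
    unfolding power_series_def by (rule summable_norm[OF summable_power_series[OF B w]])
  also have "\<dots> \<le> (\<Sum>n. K * norm w ^ n)"
    using w K by (intro suminf_le summable_power_series[OF B w] summable_mult summable_geometric)
      (auto simp: norm_mult norm_power intro!: mult_right_mono)
  also have "\<dots> = K / (1 - norm w)"
    using w by (subst suminf_mult) (auto simp: suminf_geometric intro!: summable_geometric)
  finally show ?thesis .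
qed

lemma power_series_add:
  assumes "Bseq c" "Bseq d" "norm w < 1"
  shows "power_series (\<lambda>n. c n + d n) w = power_series c w + power_series d w"
  using sums_add[OF power_series_sums[OF assms(1,3)] power_series_sums[OF assms(2,3)]]
  unfolding power_series_def by (simp add: sums_iff algebra_simps)

lemma power_series_scale:
  assumes "Bseq c" "norm w < 1"
  shows "power_series (\<lambda>n. k * c n) w = k * power_series c w"
  using sums_mult[OF power_series_sums[OF assms], of k]
  unfolding power_series_def by (simp add: sums_iff algebra_simps)

lemma Bseq_case_nat: "Bseq c \<Longrightarrow> Bseq (case_nat s c)" for c :: "nat \<Rightarrow> complex"
  by (subst Bseq_Suc_iff[symmetric]) simp

lemma power_series_case_nat:
  assumes "Bseq c" "norm w < 1"
  shows "power_series (case_nat s c) w = s + w * power_series c w"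
  using suminf_split_head[OF sums_summable[OF power_series_sums[OF Bseq_case_nat[OF assms(1), of s] assms(2)]]]
    suminf_mult[OF sums_summable[OF power_series_sums[OF assms]], of w]
  unfolding power_series_def by (simp add: algebra_simps)

lemma power_series_split_head:
  assumes "Bseq c" "norm w < 1"
  shows "power_series c w = c 0 + w * power_series (\<lambda>n. c (Suc n)) w"
proof -
  have "c = case_nat (c 0) (\<lambda>n. c (Suc n))" by (auto simp: fun_eq_iff split: nat.splits)
  then show ?thesis using power_series_case_nat[of "\<lambda>n. c (Suc n)" w "c 0"] assms
    by (metis Bseq_Suc_iff)
qed

lemma power_series_holomorphic_on:
  assumes "Bseq c"
  shows "power_series c holomorphic_on ball 0 1"
  using power_series_sums[OF assms] by (intro power_series_holomorphic[of 0 1 c]) auto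

text \<open>The origin is left out of the hypothesis because the variable
  \<open>r / (\<zeta> - b)\<close> of a hole part never takes the value 0 on the exterior of the
  hole. Continuity recovers the value there, and the isolation of zeros of a nonzero power series
  does the rest.\<close>

lemma power_series_eq_0_imp:
  assumes "Bseq c" "\<And>w. norm w < 1 \<Longrightarrow> w \<noteq> 0 \<Longrightarrow> power_series c w = 0"
  shows "c n = 0"
proof (rule ccontr)
  assume n: "c n \<noteq> 0"
  have "continuous (at 0) (power_series c)"
    using holomorphic_on_imp_continuous_on[OF power_series_holomorphic_on[OF assms(1)]]
    by (subst (asm) continuous_on_eq_continuous_at) auto
  have z: "power_series c 0 = 0"
  proof -
    have ev: "eventually (\<lambda>w. power_series c w = 0) (at 0)"
      unfolding eventually_at by (intro exI[of _ 1]) (auto intro!: assms(2))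
    have "(power_series c \<longlongrightarrow> power_series c 0) (at 0)"
      using \<open>continuous (at 0) (power_series c)\<close> by (simp add: isCont_def)
    moreover have "(power_series c \<longlongrightarrow> 0) (at 0)"
      using ev by (rule tendsto_eventually)
    ultimately show ?thesis using tendsto_unique at_neq_bot by blast
  qed
  then have n0: "n > 0"
    using n power_series_split_head[OF assms(1), of 0] by (cases n) auto
  have "(\<lambda>n. c n * (x - 0) ^ n) sums power_series c x" if "norm (x - 0) < 1" for x
    using power_series_sums[OF assms(1)] that by simp
  from powser_0_nonzero[of 1 0, OF _ this z n n0]
  obtain s where "0 < s" "\<And>z. z \<in> cball 0 s - {0} \<Longrightarrow> power_series c z \<noteq> 0" by auto
  \<comment> \<open>The bound 1/2 keeps the point inside the unit disk even if \<open>s\<close> is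
    large.\<close>
  moreover have "of_real (min s (1/2)) \<in> cball 0 s - {0::complex}" using \<open>0 < s\<close> by auto
  moreover have "power_series c (of_real (min s (1/2))) = 0" 
    using \<open>0 < s\<close> by (intro assms(2)) (auto simp: min_def)
  ultimately show False by blast
qed

text \<open>The \<open>n\<close>-th entry is the sum of \<mu>^(n-k) c_k over k \<le> n. These are
  the coefficients of the power series of \<open>c\<close> divided by 1 - \<mu> w. The recursive
  form is what the norm estimate uses.\<close>

primrec geometric_conv :: "complex \<Rightarrow> (nat \<Rightarrow> complex) \<Rightarrow> nat \<Rightarrow> complex" where
  "geometric_conv \<mu> c 0 = c 0"
| "geometric_conv \<mu> c (Suc n) = c (Suc n) + \<mu> * geometric_conv \<mu> c n"

lemma geometric_conv_eq: "geometric_conv \<mu> c = (\<lambda>n. c n + \<mu> * case_nat 0 (geometric_conv \<mu> c) n)"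
  by (auto simp: fun_eq_iff split: nat.splits)

lemma L2_set_perturbed_le:
  fixes d c h :: "nat \<Rightarrow> complex"
  assumes "\<And>n. d n = c n + \<mu> * h n"
  shows "L2_set (\<lambda>n. norm (d n)) A \<le> L2_set (\<lambda>n. norm (c n)) A + norm \<mu> * L2_set (\<lambda>n. norm (h n)) A"
proof -
  have "L2_set (\<lambda>n. norm (d n)) A \<le> L2_set (\<lambda>n. norm (c n) + norm \<mu> * norm (h n)) A"
    unfolding assms by (intro L2_set_mono) (auto intro: norm_triangle_le simp: norm_mult)
  also have "\<dots> \<le> L2_set (\<lambda>n. norm (c n)) A + L2_set (\<lambda>n. norm \<mu> * norm (h n)) A"
    by (rule L2_set_triangle_ineq)
  also have "L2_set (\<lambda>n. norm \<mu> * norm (h n)) A = norm \<mu> * L2_set (\<lambda>n. norm (h n)) A"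
    by (simp add: L2_set_right_distrib)
  finally show ?thesis .
qed

text \<open>The convolution \<open>d\<close> equals \<open>c\<close> plus \<open>\<mu>\<close> times the shift of \<open>d\<close>, so Minkowski's inequality
  on initial segments bounds it; the difference quotient below satisfies the reversed recursion.\<close>

lemma ell2_geometric_conv:
  assumes "ell2 c" "norm \<mu> < 1"
  shows "ell2 (geometric_conv \<mu> c)" "ell2_norm (geometric_conv \<mu> c) \<le> ell2_norm c / (1 - norm \<mu>)"
proof -
  let ?d = "geometric_conv \<mu> c"
  have "L2_set (\<lambda>n. norm (?d n)) {..<N} \<le> ell2_norm c / (1 - norm \<mu>)" for N
  proof -
    have 1: "L2_set (\<lambda>n. norm (?d n)) {..<N} \<le> L2_set (\<lambda>n. norm (c n)) {..<N}
        + norm \<mu> * L2_set (\<lambda>n. norm (case_nat 0 ?d n)) {..<N}"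
      by (rule L2_set_perturbed_le) (rule fun_cong[OF geometric_conv_eq])
    \<comment> \<open>Within a segment of fixed length, the shift inserts a zero and drops the last
      entry.\<close>
    have 2: "L2_set (\<lambda>n. norm (case_nat 0 ?d n)) {..<N} \<le> L2_set (\<lambda>n. norm (?d n)) {..<N}"
    proof (cases N)
      case (Suc M)
      have "(\<Sum>n<Suc M. (norm (case_nat 0 ?d n))\<^sup>2) = (\<Sum>n<M. (norm (?d n))\<^sup>2)"
        unfolding sum.lessThan_Suc_shift by simp
      also have "\<dots> \<le> (\<Sum>n<Suc M. (norm (?d n))\<^sup>2)"
        unfolding sum.lessThan_Suc by (simp del: geometric_conv.simps)
      finally show ?thesis unfolding L2_set_def Suc by (rule real_sqrt_le_mono)
    qed simp
    have 3: "L2_set (\<lambda>n. norm (c n)) {..<N} \<le> ell2_norm c"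
      using assms(1) by (intro L2_set_le_ell2_norm) auto
    \<comment> \<open>The same finite quantity stands on both sides with factor
      \<open>norm \<mu>\<close> < 1 on the right, so it can be absorbed on the left before
      \<open>?d\<close> is known to be square summable.\<close>
    have "L2_set (\<lambda>n. norm (?d n)) {..<N} \<le>
        ell2_norm c + norm \<mu> * L2_set (\<lambda>n. norm (?d n)) {..<N}"
      using 1 3 mult_left_mono[OF 2 norm_ge_zero[of \<mu>]] by linarith
    then show ?thesis using assms(2) by (simp add: field_simps)
  qed
  from ell2_bound[OF this] show "ell2 (geometric_conv \<mu> c)"
    "ell2_norm (geometric_conv \<mu> c) \<le> ell2_norm c / (1 - norm \<mu>)" .
qed

text \<open>With C and D the power series of \<open>c\<close> and of the convolution, the recursion
  reads D = C + \<mu> w D.\<close>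

lemma power_series_geometric_conv:
  assumes "ell2 c" "norm \<mu> < 1" "norm w < 1"
  shows "(1 - \<mu> * w) * power_series (geometric_conv \<mu> c) w = power_series c w"
proof -
  have B: "Bseq c" "Bseq (geometric_conv \<mu> c)"
    using assms ell2_geometric_conv(1) ell2_imp_Bseq by blast+
  have B2: "Bseq (\<lambda>n. \<mu> * case_nat 0 (geometric_conv \<mu> c) n)"
    using Bseq_case_nat[OF B(2), of 0] by (cases "\<mu> = 0") (auto simp: Bseq_cmult_iff)
  have "power_series (geometric_conv \<mu> c) w =
     power_series c w + \<mu> * (0 + w * power_series (geometric_conv \<mu> c) w)"
    by (subst geometric_conv_eq, subst power_series_add[OF B(1) B2 assms(3)],
        subst power_series_scale[OF Bseq_case_nat[OF B(2)] assms(3)],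
        subst power_series_case_nat[OF B(2) assms(3)]) simp
  then show ?thesis by (simp add: algebra_simps)
qed

text \<open>With P the power series of \<open>c\<close>, these are the Taylor coefficients at 0 of
  (P(w) - P(w0)) / (w - w0).\<close>

definition diff_quotient :: "complex \<Rightarrow> (nat \<Rightarrow> complex) \<Rightarrow> nat \<Rightarrow> complex" where
  "diff_quotient w0 c n = power_series (\<lambda>k. c (Suc n + k)) w0"

lemma Bseq_shift: "Bseq c \<Longrightarrow> Bseq (\<lambda>k. c (n + k))" for c :: "nat \<Rightarrow> complex"
  by (auto simp: Bseq_def)

lemma diff_quotient_rec:
  assumes "Bseq c" "norm w0 < 1"
  shows "diff_quotient w0 c n = c (Suc n) + w0 * diff_quotient w0 c (Suc n)"
  unfolding diff_quotient_def
  by (subst power_series_split_head[OF Bseq_shift[OF assms(1)] assms(2)]) simp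

lemma norm_diff_quotient_le:
  assumes "ell2 c" "norm w0 < 1"
  shows "norm (diff_quotient w0 c n) \<le> ell2_norm c / (1 - norm w0)"
  unfolding diff_quotient_def
  using norm_le_ell2_norm[OF assms(1)] assms(2) by (intro norm_power_series_le) auto

lemma ell2_diff_quotient:
  assumes c: "ell2 c" and w0: "norm w0 < 1"
  defines "K \<equiv> 1 / (1 - norm w0) + 1 / (1 - norm w0)\<^sup>2"
  shows "ell2 (diff_quotient w0 c)" "ell2_norm (diff_quotient w0 c) \<le> K * ell2_norm c"
proof -
  let ?q = "diff_quotient w0 c"
  have "L2_set (\<lambda>n. norm (?q n)) {..<N} \<le> K * ell2_norm c" for N
  proof -
    let ?L = "L2_set (\<lambda>n. norm (?q n)) {..<N}"
    let ?M = "ell2_norm c / (1 - norm w0)"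
    have M0: "?M \<ge> 0" using ell2_norm_nonneg[OF c] w0 by simp
    have "L2_set (\<lambda>n. norm (c (Suc n))) {..<N} \<le> L2_set (\<lambda>n. norm (c n)) {..<Suc N}"
      unfolding L2_set_def sum.lessThan_Suc_shift by simp
    also have "\<dots> \<le> ell2_norm c" using c by (intro L2_set_le_ell2_norm) auto
    finally have 1: "L2_set (\<lambda>n. norm (c (Suc n))) {..<N} \<le> ell2_norm c" .
    \<comment> \<open>The recursion refers to the next entry, so the shifted segment reaches index
      \<open>N\<close>, one past \<open>?L\<close>. The pointwise bound \<open>?M\<close> controls
      that extra entry, and \<open>?L\<close> is then absorbed on the left as for the
      convolution.\<close>
    have "L2_set (\<lambda>n. norm (?q (Suc n))) {..<N} \<le> L2_set (\<lambda>n. norm (?q n)) {..<Suc N}"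
      unfolding L2_set_def sum.lessThan_Suc_shift by simp
    also have "\<dots> \<le> norm (?q N) + ?L"
      using sqrt_sum_squares_le_sum[of "norm (?q N)" ?L]
      by (simp add: lessThan_Suc L2_set_nonneg)
    also have "\<dots> \<le> ?M + ?L" using norm_diff_quotient_le[OF c w0] by simp
    finally have 2: "L2_set (\<lambda>n. norm (?q (Suc n))) {..<N} \<le> ?M + ?L" .
    have "?L \<le> L2_set (\<lambda>n. norm (c (Suc n))) {..<N} + norm w0 * L2_set (\<lambda>n. norm (?q (Suc n))) {..<N}"
      by (rule L2_set_perturbed_le) (rule diff_quotient_rec[OF ell2_imp_Bseq[OF c] w0])
    also have "\<dots> \<le> ell2_norm c + norm w0 * (?M + ?L)"
      by (intro add_mono mult_left_mono 1 2) auto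
    finally have "(1 - norm w0) * ?L \<le> ell2_norm c + norm w0 * ?M" by (simp add: algebra_simps)
    also have "\<dots> \<le> ell2_norm c + 1 * ?M"
      using w0 M0 by (intro add_mono mult_right_mono) auto
    finally have "?L * (1 - norm w0) \<le> ell2_norm c + ?M" by (simp add: mult.commute)
    then have "?L \<le> (ell2_norm c + ?M) / (1 - norm w0)"
      using w0 by (simp add: pos_le_divide_eq)
    also have "\<dots> = K * ell2_norm c"
      unfolding K_def by (simp add: add_divide_distrib distrib_right power2_eq_square)
    finally show ?thesis .
  qed
  from ell2_bound[OF this] show "ell2 ?q" "ell2_norm ?q \<le> K * ell2_norm c" .
qed

text \<open>With P and Q the power series of \<open>c\<close> and \<open>?q\<close>, multiplying the
  recursion by w and summing gives w Q(w) = P(w) - c_0 + w0 (Q(w) - q_0), and c_0 + w0 q_0 =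
  P(w0).\<close>

lemma power_series_diff_quotient:
  assumes "ell2 c" "norm w0 < 1" "norm w < 1"
  shows "power_series c w = (w - w0) * power_series (diff_quotient w0 c) w + power_series c w0"
proof -
  let ?q = "diff_quotient w0 c"
  have B: "Bseq c" "Bseq ?q" using assms ell2_diff_quotient(1) ell2_imp_Bseq by blast+
  have Bs: "Bseq (\<lambda>n. c (Suc n))" "Bseq (\<lambda>n. ?q (Suc n))"
    using Bseq_shift[OF B(1), of 1] Bseq_shift[OF B(2), of 1] by auto
  have Bw: "Bseq (\<lambda>n. w0 * ?q (Suc n))" 
    using Bs(2) by (cases "w0 = 0") (auto simp: Bseq_cmult_iff)
  have "power_series ?q w = power_series (\<lambda>n. c (Suc n) + w0 * ?q (Suc n)) w"
    by (rule arg_cong[of _ _ "\<lambda>c. power_series c w"], rule ext, rule diff_quotient_rec[OF B(1) assms(2)])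
  also have "\<dots> = power_series (\<lambda>n. c (Suc n)) w + w0 * power_series (\<lambda>n. ?q (Suc n)) w"
    by (simp add: power_series_add[OF Bs(1) Bw assms(3)] power_series_scale[OF Bs(2) assms(3)])
  finally have 1: "power_series ?q w = power_series (\<lambda>n. c (Suc n)) w + w0 * power_series (\<lambda>n. ?q (Suc n)) w" .
  have 2: "power_series c w = c 0 + w * power_series (\<lambda>n. c (Suc n)) w"
    by (rule power_series_split_head[OF B(1) assms(3)])
  have 3: "power_series ?q w = ?q 0 + w * power_series (\<lambda>n. ?q (Suc n)) w"
    by (rule power_series_split_head[OF B(2) assms(3)])
  have 4: "power_series c w0 = c 0 + w0 * ?q 0"
    using power_series_split_head[OF B(1) assms(2)] by (simp add: diff_quotient_def)
  have "w * power_series ?q w = w * power_series (\<lambda>n. c (Suc n)) w + w0 * (w * power_series (\<lambda>n. ?q (Suc n)) w)"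
    using 1 by (simp add: algebra_simps)
  also have "w * power_series (\<lambda>n. c (Suc n)) w = power_series c w - c 0" using 2 by simp
  also have "w * power_series (\<lambda>n. ?q (Suc n)) w = power_series ?q w - ?q 0" using 3 by simp
  finally show ?thesis using 4 by (simp add: algebra_simps)
qed

lemma power_series_geometric:
  assumes "norm (\<mu> * w) < 1"
  shows "(1 - \<mu> * w) * power_series (\<lambda>n. k * \<mu> ^ n) w = k"
proof -
  have "(\<lambda>n. k * (\<mu> * w) ^ n) sums (k * (1 / (1 - \<mu> * w)))"
    by (intro sums_mult geometric_sums assms)
  then have "power_series (\<lambda>n. k * \<mu> ^ n) w = k * (1 / (1 - \<mu> * w))"
    unfolding power_series_def by (simp add: sums_iff power_mult_distrib mult.assoc)
  moreover have "1 - \<mu> * w \<noteq> 0" using assms by auto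
  ultimately show ?thesis by simp
qed

text \<open>Such sequences are the coefficients of 1/(\<zeta> - l) for \<open>l\<close> on a
  boundary circle. Their terms have constant nonzero modulus, so the squares do not tend to
  0.\<close>

lemma not_ell2_unimodular_geometric:
  assumes "norm \<mu> = 1" "k \<noteq> 0"
  shows "Bseq (\<lambda>n. k * \<mu> ^ n)" "\<not> ell2 (\<lambda>n. k * \<mu> ^ n)"
proof -
  have *: "norm (k * \<mu> ^ n) = norm k" for n using assms by (simp add: norm_mult norm_power)
  show "Bseq (\<lambda>n. k * \<mu> ^ n)" by (rule BseqI'[of _ "norm k"]) (simp add: *)
  show "\<not> ell2 (\<lambda>n. k * \<mu> ^ n)" unfolding ell2_def * using assms
    by (auto dest: summable_LIMSEQ_zero simp: LIMSEQ_const_iff)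
qed

subsection \<open>Division by a linear factor\<close>

text \<open>The \<open>n\<close>-th coefficient belongs to the exponent \<open>-1 - n\<close> of \<open>(\<zeta> - b)/r\<close>.\<close>

definition hole_part :: "complex \<Rightarrow> real \<Rightarrow> (nat \<Rightarrow> complex) \<Rightarrow> complex \<Rightarrow> complex" where
  "hole_part b r c \<zeta> = of_real r / (\<zeta> - b) * power_series c (of_real r / (\<zeta> - b))"

definition exterior_disk :: "complex \<Rightarrow> real \<Rightarrow> complex set" where
  "exterior_disk b r = - cball b r"

lemma mem_exterior_disk_iff: "\<zeta> \<in> exterior_disk b r \<longleftrightarrow> norm (\<zeta> - b) > r"
  unfolding exterior_disk_def by (auto simp: dist_norm norm_minus_commute)

lemma power_series_zero [simp]: "power_series (\<lambda>_. 0) w = 0"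
  by (simp add: power_series_def)

lemma hole_part_zero [simp]: "hole_part b r (\<lambda>_. 0) w = 0"
  by (simp add: hole_part_def)

text \<open>Describes a piece \<open>V\<close> whose domain \<open>D\<close> contains
  \<open>l\<close>: division by \<zeta> - l stays in the piece up to the polar term s/(\<zeta> - l).
  The constant \<open>K\<close> is uniform in \<open>c\<close>, which later makes the resolvent
  bounded.\<close>

definition splits_off_pole ::
  "((nat \<Rightarrow> complex) \<Rightarrow> complex \<Rightarrow> complex) \<Rightarrow> complex set \<Rightarrow> complex \<Rightarrow> bool" where
  "splits_off_pole V D l \<longleftrightarrow> (\<exists>K\<ge>0. \<forall>c. ell2 c \<longrightarrow> (\<exists>c' s. ell2 c' \<and>
     ell2_norm c' \<le> K * ell2_norm c \<and> norm s \<le> K * ell2_norm c \<and>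
     (\<forall>\<zeta>\<in>D. V c \<zeta> = (\<zeta> - l) * V c' \<zeta> + s)))"

text \<open>Describes the piece for which \<open>l\<close> lies outside the closure of
  \<open>D\<close>. There 1/(\<zeta> - l) belongs to the piece itself, so the constant
  \<open>s\<close> left over by the other pieces can be taken in.\<close>

definition absorbs_pole ::
  "((nat \<Rightarrow> complex) \<Rightarrow> complex \<Rightarrow> complex) \<Rightarrow> complex set \<Rightarrow> complex \<Rightarrow> bool" where
  "absorbs_pole V D l \<longleftrightarrow> (\<exists>K\<ge>0. \<forall>c s. ell2 c \<longrightarrow> (\<exists>c'. ell2 c' \<and>
     ell2_norm c' \<le> K * (ell2_norm c + norm s) \<and>
     (\<forall>\<zeta>\<in>D. V c \<zeta> + s = (\<zeta> - l) * V c' \<zeta>)))"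

lemma splits_off_poleI:
  assumes "K1 \<ge> 0" "K2 \<ge> 0"
    and "\<And>c. ell2 c \<Longrightarrow> ell2 (T c)"
    and "\<And>c. ell2 c \<Longrightarrow> ell2_norm (T c) \<le> K1 * ell2_norm c"
    and "\<And>c. ell2 c \<Longrightarrow> norm (p c) \<le> K2 * ell2_norm c"
    and "\<And>c \<zeta>. ell2 c \<Longrightarrow> \<zeta> \<in> D \<Longrightarrow> V c \<zeta> = (\<zeta> - l) * V (T c) \<zeta> + p c"
  shows "splits_off_pole V D l"
  unfolding splits_off_pole_def
proof (intro exI[of _ "K1 + K2"] conjI allI impI)
  fix c assume c: "ell2 c"
  have "K1 * ell2_norm c \<le> (K1 + K2) * ell2_norm c" "K2 * ell2_norm c \<le> (K1 + K2) * ell2_norm c"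
    using assms(1,2) ell2_norm_nonneg[OF c] by (auto intro!: mult_right_mono)
  then have b: "ell2_norm (T c) \<le> (K1 + K2) * ell2_norm c" "norm (p c) \<le> (K1 + K2) * ell2_norm c"
    using assms(4)[OF c] assms(5)[OF c] by linarith+
  show "\<exists>c' s. ell2 c' \<and> ell2_norm c' \<le> (K1 + K2) * ell2_norm c \<and>
     norm s \<le> (K1 + K2) * ell2_norm c \<and> (\<forall>\<zeta>\<in>D. V c \<zeta> = (\<zeta> - l) * V c' \<zeta> + s)"
    by (rule exI[of _ "T c"], rule exI[of _ "p c"], intro conjI ballI assms(3)[OF c] b assms(6)[OF c])
next
  show "0 \<le> K1 + K2" using assms(1,2) by simp
qed

lemma disk_splits_off_pole:
  assumes "norm l < 1"
  shows "splits_off_pole power_series (ball 0 1) l"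
proof (rule splits_off_poleI[of "1 / (1 - norm l) + 1 / (1 - norm l)\<^sup>2" "1 / (1 - norm l)"
      "diff_quotient l" "\<lambda>c. power_series c l"])
  show "0 \<le> 1 / (1 - norm l) + 1 / (1 - norm l)\<^sup>2" "0 \<le> 1 / (1 - norm l)"
    using assms by auto
  fix c assume c: "ell2 c"
  show "norm (power_series c l) \<le> 1 / (1 - norm l) * ell2_norm c"
    using norm_power_series_le[OF norm_le_ell2_norm[OF c] assms] by simp
  show "ell2 (diff_quotient l c)"
    "ell2_norm (diff_quotient l c) \<le> (1 / (1 - norm l) + 1 / (1 - norm l)\<^sup>2) * ell2_norm c"
    using ell2_diff_quotient[OF c assms] .
  fix \<zeta> :: complex assume "\<zeta> \<in> ball 0 1"
  then show "power_series c \<zeta> = (\<zeta> - l) * power_series (diff_quotient l c) \<zeta> + power_series c l"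
    by (intro power_series_diff_quotient[OF c assms]) simp
qed

text \<open>In the variable w = r/(\<zeta> - b) the hole part is the power series of
  \<open>case_nat 0 c\<close>, and \<open>l\<close> corresponds to \<open>w0\<close>. The difference
  quotient at \<open>w0\<close> therefore applies, as it does for the disk at
  \<open>l\<close>.\<close>

lemma hole_splits_off_pole:
  assumes l: "l \<in> exterior_disk b r" and r: "r > 0"
  shows "splits_off_pole (hole_part b r) (exterior_disk b r) l"
proof -
  define m where "m = l - b"
  define w0 where "w0 = of_real r / m"
  have m: "norm m > r" "m \<noteq> 0" using l r by (auto simp: mem_exterior_disk_iff m_def)
  have w0: "norm w0 < 1" using m r by (simp add: w0_def norm_divide)
  define K where "K = 1 / (1 - norm w0) + 1 / (1 - norm w0)\<^sup>2"
  define T where "T c = (\<lambda>n. - (1 / m) * diff_quotient w0 (case_nat 0 c) n)" for c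
  define p where "p c = power_series (case_nat 0 c) w0" for c
  show ?thesis
  proof (rule splits_off_poleI[of "norm (1 / m) * K" "1 / (1 - norm w0)" T p])
    show "0 \<le> norm (1 / m) * K" "0 \<le> 1 / (1 - norm w0)" using w0 by (auto simp: K_def)
    fix c assume c: "ell2 c"
    note c0 = ell2_case_nat_0[OF c]
    have q: "ell2 (diff_quotient w0 (case_nat 0 c))"
      "ell2_norm (diff_quotient w0 (case_nat 0 c)) \<le> K * ell2_norm c"
      using ell2_diff_quotient[OF c0(1) w0] c0(2) by (auto simp: K_def)
    show "ell2 (T c)" unfolding T_def by (rule ell2_scale(1)[OF q(1)])
    show "ell2_norm (T c) \<le> norm (1 / m) * K * ell2_norm c"
    proof -
      have "ell2_norm (T c) = norm (1 / m) * ell2_norm (diff_quotient w0 (case_nat 0 c))"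
        unfolding T_def by (subst ell2_scale(2)[OF q(1)]) simp
      also have "\<dots> \<le> norm (1 / m) * (K * ell2_norm c)" by (intro mult_left_mono q(2)) simp
      finally show ?thesis by (simp add: mult.assoc)
    qed
    show "norm (p c) \<le> 1 / (1 - norm w0) * ell2_norm c"
      using norm_power_series_le[OF norm_le_ell2_norm[OF c0(1)] w0] by (simp add: p_def c0(2))
    fix \<zeta> assume z: "\<zeta> \<in> exterior_disk b r"
    define w where "w = of_real r / (\<zeta> - b)"
    have z0: "norm (\<zeta> - b) > r" "\<zeta> - b \<noteq> 0" using z r by (auto simp: mem_exterior_disk_iff)
    have w: "norm w < 1" using z0 r by (simp add: w_def norm_divide)
    \<comment> \<open>The factor \<open>w\<close> appearing here is the prefactor in
      \<open>hole_part\<close>, so the quotient is again a hole part. The factor -1/m accounts for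
      the scaling in \<open>T\<close>.\<close>
    have ww: "w - w0 = - ((\<zeta> - l) * w / m)"
      using m z0 by (simp add: w_def w0_def field_simps) (simp add: m_def algebra_simps)
    have "hole_part b r c \<zeta> = power_series (case_nat 0 c) w"
      by (simp add: hole_part_def w_def[symmetric] power_series_case_nat[OF ell2_imp_Bseq[OF c] w])
    also have "\<dots> = (w - w0) * power_series (diff_quotient w0 (case_nat 0 c)) w + p c"
      unfolding p_def by (rule power_series_diff_quotient[OF c0(1) w0 w])
    also have "(w - w0) * power_series (diff_quotient w0 (case_nat 0 c)) w = (\<zeta> - l) * hole_part b r (T c) \<zeta>"
      unfolding T_def hole_part_def w_def[symmetric] power_series_scale[OF ell2_imp_Bseq[OF q(1)] w] ww
      by simp
    finally show "hole_part b r c \<zeta> = (\<zeta> - l) * hole_part b r (T c) \<zeta> + p c" .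
  qed
qed

text \<open>Since \<zeta> - l = -l (1 - \<zeta>/l) and |1/l| < 1, dividing by \<zeta> - l is a
  convolution with the powers of 1/l, up to the factor -1/l. The constant \<open>s\<close> is first
  added to the zeroth coefficient.\<close>

lemma disk_absorbs_pole:
  assumes l: "norm l > 1"
  shows "absorbs_pole power_series (ball 0 1) l"
proof -
  have l0: "l \<noteq> 0" and m: "norm (1 / l) < 1" using l by (auto simp: norm_divide divide_less_eq)
  define K where "K = norm (1 / l) / (1 - norm (1 / l))"
  have "K \<ge> 0" using m by (auto simp: K_def)
  moreover have "\<exists>c'. ell2 c' \<and> ell2_norm c' \<le> K * (ell2_norm c + norm s) \<and>
     (\<forall>\<zeta>\<in>ball 0 1. power_series c \<zeta> + s = (\<zeta> - l) * power_series c' \<zeta>)" if c: "ell2 c" for c s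
  proof -
    define d where "d = (\<lambda>n. c n + (if n = 0 then s else 0))"
    have d: "ell2 d" "ell2_norm d \<le> ell2_norm c + norm s"
      using ell2_add[OF c ell2_single(1)[of s]] by (simp_all add: d_def ell2_single(2))
    note g = ell2_geometric_conv[OF d(1) m]
    define c' where "c' = (\<lambda>n. - (1 / l) * geometric_conv (1 / l) d n)"
    show ?thesis
    proof (intro exI[of _ c'] conjI ballI)
      show "ell2 c'" unfolding c'_def by (rule ell2_scale(1)[OF g(1)])
      have "ell2_norm c' = norm (1 / l) * ell2_norm (geometric_conv (1 / l) d)"
        unfolding c'_def by (subst ell2_scale(2)[OF g(1)]) (simp add: norm_divide)
      also have "\<dots> \<le> norm (1 / l) * (ell2_norm d / (1 - norm (1 / l)))"
        by (intro mult_left_mono g(2)) auto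
      also have "\<dots> = K * ell2_norm d" by (simp add: K_def)
      also have "\<dots> \<le> K * (ell2_norm c + norm s)" using \<open>K \<ge> 0\<close> by (intro mult_left_mono d(2))
      finally show "ell2_norm c' \<le> K * (ell2_norm c + norm s)" .
      fix \<zeta> :: complex assume "\<zeta> \<in> ball 0 1"
      then have z: "norm \<zeta> < 1" by simp
      have "power_series c \<zeta> + s = power_series c \<zeta> + (power_series (\<lambda>n. if n = 0 then s else 0) \<zeta>)"
        unfolding power_series_def by (subst suminf_finite[of "{0}"]) auto
      also have "\<dots> = power_series d \<zeta>"
        unfolding d_def using c ell2_single(1)[of s] z by (subst power_series_add) (auto intro: ell2_imp_Bseq)
      also have "\<dots> = (1 - 1 / l * \<zeta>) * power_series (geometric_conv (1 / l) d) \<zeta>"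
        by (rule power_series_geometric_conv[OF d(1) m z, symmetric])
      also have "\<dots> = (\<zeta> - l) * power_series c' \<zeta>"
        unfolding c'_def power_series_scale[OF ell2_imp_Bseq[OF g(1)] z] using l0 by (simp add: field_simps)
      finally show "power_series c \<zeta> + s = (\<zeta> - l) * power_series c' \<zeta>" .
    qed
  qed
  ultimately show ?thesis unfolding absorbs_pole_def by blast
qed

text \<open>As a power series in w = r/(\<zeta> - b), \<open>hole_part b r c\<close> plus
  \<open>s\<close> has the coefficients \<open>case_nat s c\<close>. Since \<zeta> - l = (1 - \<mu>
  w) r/w, division by \<zeta> - l is a geometric convolution followed by multiplication with w/r,
  and the factor w turns the result into a hole part.\<close>

lemma hole_absorbs_pole:
  assumes l: "norm (l - b) < r"
  shows "absorbs_pole (hole_part b r) (exterior_disk b r) l"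
proof -
  have r: "r > 0" using l by (smt (verit) norm_ge_zero)
  define \<mu> where "\<mu> = (l - b) / of_real r"
  have m: "norm \<mu> < 1" using l r by (simp add: \<mu>_def norm_divide)
  define K where "K = (1 / r) / (1 - norm \<mu>)"
  have "K \<ge> 0" using m r by (auto simp: K_def)
  moreover have "\<exists>c'. ell2 c' \<and> ell2_norm c' \<le> K * (ell2_norm c + norm s) \<and>
     (\<forall>\<zeta>\<in>exterior_disk b r. hole_part b r c \<zeta> + s = (\<zeta> - l) * hole_part b r c' \<zeta>)" if c: "ell2 c" for c s
  proof -
    note d = ell2_case_nat[OF c, of s]
    note g = ell2_geometric_conv[OF d(1) m]
    define c' where "c' = (\<lambda>n. of_real (1 / r) * geometric_conv \<mu> (case_nat s c) n)"
    show ?thesis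
    proof (intro exI[of _ c'] conjI ballI)
      show "ell2 c'" unfolding c'_def by (rule ell2_scale(1)[OF g(1)])
      have "ell2_norm c' = (1 / r) * ell2_norm (geometric_conv \<mu> (case_nat s c))"
        unfolding c'_def using r by (subst ell2_scale(2)[OF g(1)]) (simp add: norm_divide)
      also have "\<dots> \<le> (1 / r) * (ell2_norm (case_nat s c) / (1 - norm \<mu>))"
        using r by (intro mult_left_mono g(2)) auto
      also have "\<dots> = K * ell2_norm (case_nat s c)" by (simp add: K_def)
      also have "\<dots> \<le> K * (ell2_norm c + norm s)" using \<open>K \<ge> 0\<close> by (intro mult_left_mono d(2))
      finally show "ell2_norm c' \<le> K * (ell2_norm c + norm s)" .
      fix \<zeta> :: complex assume z: "\<zeta> \<in> exterior_disk b r"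
      define w where "w = of_real r / (\<zeta> - b)"
      have z0: "norm (\<zeta> - b) > r" "\<zeta> - b \<noteq> 0" using z r by (auto simp: mem_exterior_disk_iff)
      have w: "norm w < 1" using z0 r by (simp add: w_def norm_divide)
      have mw: "1 - \<mu> * w = (\<zeta> - l) * (w * of_real (1 / r))"
        using z0 r by (simp add: \<mu>_def w_def field_simps)
      have "hole_part b r c \<zeta> + s = power_series (case_nat s c) w"
        by (simp add: hole_part_def w_def[symmetric] power_series_case_nat[OF ell2_imp_Bseq[OF c] w])
      also have "\<dots> = (1 - \<mu> * w) * power_series (geometric_conv \<mu> (case_nat s c)) w"
        by (rule power_series_geometric_conv[OF d(1) m w, symmetric])
      also have "\<dots> = (\<zeta> - l) * hole_part b r c' \<zeta>"
        unfolding c'_def hole_part_def w_def[symmetric] power_series_scale[OF ell2_imp_Bseq[OF g(1)] w] mw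
        by simp
      finally show "hole_part b r c \<zeta> + s = (\<zeta> - l) * hole_part b r c' \<zeta>" .
    qed
  qed
  ultimately show ?thesis unfolding absorbs_pole_def by blast
qed

text \<open>The geometric series 1/(\<zeta> - l) = -(1/l) (1 + \<zeta>/l + (\<zeta>/l)^2 + ...) has
  coefficients of modulus 1.\<close>

lemma disk_boundary_pole:
  assumes l: "norm l = 1"
  obtains c where "Bseq c" "\<not> ell2 c" "\<And>\<zeta>. \<zeta> \<in> ball 0 1 \<Longrightarrow> (\<zeta> - l) * power_series c \<zeta> = 1"
proof -
  have l0: "l \<noteq> 0" using l by auto
  show ?thesis
  proof (rule that)
    show "Bseq (\<lambda>n. - (1 / l) * (1 / l) ^ n)" "\<not> ell2 (\<lambda>n. - (1 / l) * (1 / l) ^ n)"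
      using not_ell2_unimodular_geometric[of "1 / l" "- (1 / l)"] l l0 by (auto simp: norm_divide)
    fix \<zeta> :: complex assume "\<zeta> \<in> ball 0 1"
    then have "(1 - 1 / l * \<zeta>) * power_series (\<lambda>n. - (1 / l) * (1 / l) ^ n) \<zeta> = - (1 / l)"
      using l by (intro power_series_geometric) (simp add: norm_divide)
    moreover have "\<zeta> - l = - l * (1 - 1 / l * \<zeta>)" using l0 by (simp add: field_simps)
    ultimately show "(\<zeta> - l) * power_series (\<lambda>n. - (1 / l) * (1 / l) ^ n) \<zeta> = 1"
      using l0 by (simp add: mult.assoc)
  qed
qed

text \<open>With w = r/(\<zeta> - b), one has 1/(\<zeta> - l) = (w/r) (1 + \<mu> w + (\<mu> w)^2 +
  ...), where |\<mu>| = 1.\<close>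

lemma hole_boundary_pole:
  assumes l: "norm (l - b) = r" and r: "r > 0"
  obtains c where "Bseq c" "\<not> ell2 c" "\<And>\<zeta>. \<zeta> \<in> exterior_disk b r \<Longrightarrow> (\<zeta> - l) * hole_part b r c \<zeta> = 1"
proof -
  define \<mu> where "\<mu> = (l - b) / of_real r"
  have m: "norm \<mu> = 1" using l r by (simp add: \<mu>_def norm_divide)
  let ?c = "\<lambda>n. of_real (1 / r) * \<mu> ^ n"
  show ?thesis
  proof (rule that)
    show "Bseq ?c" "\<not> ell2 ?c"
      using not_ell2_unimodular_geometric[of \<mu> "of_real (1 / r)"] m r by auto
    fix \<zeta> :: complex assume z: "\<zeta> \<in> exterior_disk b r"
    define w where "w = of_real r / (\<zeta> - b)"
    have z0: "norm (\<zeta> - b) > r" "\<zeta> - b \<noteq> 0" using z r by (auto simp: mem_exterior_disk_iff)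
    have w: "norm w < 1" using z0 r by (simp add: w_def norm_divide)
    have mw: "\<zeta> - l = (1 - \<mu> * w) * (\<zeta> - b)"
      using z0 r by (simp add: \<mu>_def w_def field_simps)
    have "(\<zeta> - l) * hole_part b r ?c \<zeta> = ((\<zeta> - b) * w) * ((1 - \<mu> * w) * power_series ?c w)"
      unfolding hole_part_def w_def[symmetric] mw by simp
    also have "(1 - \<mu> * w) * power_series ?c w = of_real (1 / r)"
      using m w by (intro power_series_geometric) (simp add: norm_mult)
    also have "((\<zeta> - b) * w) * of_real (1 / r) = 1" using z0 r by (simp add: w_def)
    finally show "(\<zeta> - l) * hole_part b r ?c \<zeta> = 1" .
  qed
qed

section \<open>Dividing a sum of three pieces\<close>

definition divisible_sums ::
  "((nat \<Rightarrow> complex) \<Rightarrow> complex \<Rightarrow> complex) \<Rightarrow> ((nat \<Rightarrow> complex) \<Rightarrow> complex \<Rightarrow> complex) \<Rightarrow>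
   ((nat \<Rightarrow> complex) \<Rightarrow> complex \<Rightarrow> complex) \<Rightarrow> complex set \<Rightarrow> complex \<Rightarrow> bool" where
  "divisible_sums V1 V2 V3 D l \<longleftrightarrow> (\<exists>K\<ge>0. \<forall>x y z. ell2 x \<longrightarrow> ell2 y \<longrightarrow> ell2 z \<longrightarrow> (\<exists>x' y' z'.
     ell2 x' \<and> ell2 y' \<and> ell2 z' \<and>
     ell2_norm x' + ell2_norm y' + ell2_norm z' \<le> K * (ell2_norm x + ell2_norm y + ell2_norm z) \<and>
     (\<forall>\<zeta>\<in>D. V1 x \<zeta> + V2 y \<zeta> + V3 z \<zeta> = (\<zeta> - l) * (V1 x' \<zeta> + V2 y' \<zeta> + V3 z' \<zeta>))))"

text \<open>Serves to restore the order disk, first hole, second hole after an argument that puts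
  the absorbing piece first.\<close>

lemma divisible_sums_rotate:
  assumes "divisible_sums V1 V2 V3 D l"
  shows "divisible_sums V2 V3 V1 D l"
proof -
  obtain K where K: "K \<ge> 0" and *: "\<And>x y z. ell2 x \<Longrightarrow> ell2 y \<Longrightarrow> ell2 z \<Longrightarrow> \<exists>x' y' z'.
     ell2 x' \<and> ell2 y' \<and> ell2 z' \<and>
     ell2_norm x' + ell2_norm y' + ell2_norm z' \<le> K * (ell2_norm x + ell2_norm y + ell2_norm z) \<and>
     (\<forall>\<zeta>\<in>D. V1 x \<zeta> + V2 y \<zeta> + V3 z \<zeta> = (\<zeta> - l) * (V1 x' \<zeta> + V2 y' \<zeta> + V3 z' \<zeta>))"
    using assms unfolding divisible_sums_def by blast
  show ?thesis unfolding divisible_sums_def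
  proof (intro exI[of _ K] conjI K allI impI)
    fix y z x assume "ell2 y" "ell2 z" "ell2 x"
    from *[OF this(3,1,2)]
    obtain x' y' z' where c: "ell2 x'" "ell2 y'" "ell2 z'"
      and b: "ell2_norm x' + ell2_norm y' + ell2_norm z' \<le> K * (ell2_norm x + ell2_norm y + ell2_norm z)"
      and eq: "\<And>\<zeta>. \<zeta> \<in> D \<Longrightarrow>
        V1 x \<zeta> + V2 y \<zeta> + V3 z \<zeta> = (\<zeta> - l) * (V1 x' \<zeta> + V2 y' \<zeta> + V3 z' \<zeta>)"
      by blast
    have "ell2_norm y' + ell2_norm z' + ell2_norm x' \<le> K * (ell2_norm y + ell2_norm z + ell2_norm x)"
      using b by (simp only: add_ac)
    moreover have "V2 y \<zeta> + V3 z \<zeta> + V1 x \<zeta> = (\<zeta> - l) * (V2 y' \<zeta> + V3 z' \<zeta> + V1 x' \<zeta>)"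
      if "\<zeta> \<in> D" for \<zeta>
      using eq[OF that] by (simp only: add_ac)
    ultimately show "\<exists>y' z' x'. ell2 y' \<and> ell2 z' \<and> ell2 x' \<and>
     ell2_norm y' + ell2_norm z' + ell2_norm x' \<le> K * (ell2_norm y + ell2_norm z + ell2_norm x) \<and>
     (\<forall>\<zeta>\<in>D. V2 y \<zeta> + V3 z \<zeta> + V1 x \<zeta> = (\<zeta> - l) * (V2 y' \<zeta> + V3 z' \<zeta> + V1 x' \<zeta>))"
      using c by blast
  qed
qed

lemma divisible_sumsI:
  assumes X: "absorbs_pole VX DX l" and Y: "splits_off_pole VY DY l" and Z: "splits_off_pole VZ DZ l"
    and D: "D \<subseteq> DX \<inter> DY \<inter> DZ"
  shows "divisible_sums VX VY VZ D l"
proof -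
  obtain KX where KX: "KX \<ge> 0" "\<And>c s. ell2 c \<Longrightarrow> \<exists>c'. ell2 c' \<and> ell2_norm c' \<le> KX * (ell2_norm c + norm s) \<and>
     (\<forall>\<zeta>\<in>DX. VX c \<zeta> + s = (\<zeta> - l) * VX c' \<zeta>)" using X unfolding absorbs_pole_def by blast
  obtain KY where KY: "KY \<ge> 0" "\<And>c. ell2 c \<Longrightarrow> \<exists>c' s. ell2 c' \<and>
     ell2_norm c' \<le> KY * ell2_norm c \<and> norm s \<le> KY * ell2_norm c \<and>
     (\<forall>\<zeta>\<in>DY. VY c \<zeta> = (\<zeta> - l) * VY c' \<zeta> + s)" using Y unfolding splits_off_pole_def by blast
  obtain KZ where KZ: "KZ \<ge> 0" "\<And>c. ell2 c \<Longrightarrow> \<exists>c' s. ell2 c' \<and>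
     ell2_norm c' \<le> KZ * ell2_norm c \<and> norm s \<le> KZ * ell2_norm c \<and>
     (\<forall>\<zeta>\<in>DZ. VZ c \<zeta> = (\<zeta> - l) * VZ c' \<zeta> + s)" using Z unfolding splits_off_pole_def by blast
  \<comment> \<open>The mixed products come from the constants \<open>s\<close> and
    \<open>t\<close>, which are bounded through \<open>KY\<close> and \<open>KZ\<close> and then
    absorbed at cost \<open>KX\<close>.\<close>
  define K where "K = KX + KX * KY + KX * KZ + KY + KZ"
  have nn: "0 \<le> KX" "0 \<le> KX * KY" "0 \<le> KX * KZ" "0 \<le> KY" "0 \<le> KZ" using KX KY KZ by auto
  show ?thesis unfolding divisible_sums_def
  proof (intro exI[of _ K] conjI allI impI)
    show "K \<ge> 0" using nn by (simp add: K_def)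
    fix x y z assume x: "ell2 x" and y: "ell2 y" and z: "ell2 z"
    obtain y' s where y': "ell2 y'" "ell2_norm y' \<le> KY * ell2_norm y" "norm s \<le> KY * ell2_norm y"
      "\<And>\<zeta>. \<zeta> \<in> DY \<Longrightarrow> VY y \<zeta> = (\<zeta> - l) * VY y' \<zeta> + s" using KY(2)[OF y] by blast
    obtain z' t where z': "ell2 z'" "ell2_norm z' \<le> KZ * ell2_norm z" "norm t \<le> KZ * ell2_norm z"
      "\<And>\<zeta>. \<zeta> \<in> DZ \<Longrightarrow> VZ z \<zeta> = (\<zeta> - l) * VZ z' \<zeta> + t" using KZ(2)[OF z] by blast
    \<comment> \<open>The two constants split off from \<open>y\<close> and \<open>z\<close> are
      handed over to the absorbing piece.\<close>
    obtain x' where x': "ell2 x'" "ell2_norm x' \<le> KX * (ell2_norm x + norm (s + t))"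
      "\<And>\<zeta>. \<zeta> \<in> DX \<Longrightarrow> VX x \<zeta> + (s + t) = (\<zeta> - l) * VX x' \<zeta>" using KX(2)[OF x] by blast
    let ?N = "ell2_norm x + ell2_norm y + ell2_norm z"
    have N: "ell2_norm x \<le> ?N" "ell2_norm y \<le> ?N" "ell2_norm z \<le> ?N"
      using ell2_norm_nonneg[OF x] ell2_norm_nonneg[OF y] ell2_norm_nonneg[OF z] by auto
    have "norm (s + t) \<le> KY * ell2_norm y + KZ * ell2_norm z"
      using norm_triangle_ineq[of s t] y'(3) z'(3) by simp
    then have "ell2_norm x' \<le> KX * (ell2_norm x + (KY * ell2_norm y + KZ * ell2_norm z))"
      using x'(2) mult_left_mono[OF add_left_mono KX(1), of "norm (s + t)" _ "ell2_norm x"]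
      by (meson order.trans)
    also have "\<dots> = KX * ell2_norm x + (KX * KY) * ell2_norm y + (KX * KZ) * ell2_norm z"
      by (simp add: algebra_simps)
    also have "\<dots> \<le> KX * ?N + (KX * KY) * ?N + (KX * KZ) * ?N"
      by (intro add_mono mult_left_mono N nn)
    finally have "ell2_norm x' \<le> KX * ?N + (KX * KY) * ?N + (KX * KZ) * ?N" .
    moreover have "ell2_norm y' \<le> KY * ?N"
      using y'(2) mult_left_mono[OF N(2) nn(4)] by linarith
    moreover have "ell2_norm z' \<le> KZ * ?N"
      using z'(2) mult_left_mono[OF N(3) nn(5)] by linarith
    moreover have "K * ?N = KX * ?N + (KX * KY) * ?N + (KX * KZ) * ?N + KY * ?N + KZ * ?N"
      unfolding K_def by (simp only: distrib_right)
    ultimately have "ell2_norm x' + ell2_norm y' + ell2_norm z' \<le> K * ?N" by linarith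
    moreover have "VX x \<zeta> + VY y \<zeta> + VZ z \<zeta> = (\<zeta> - l) * (VX x' \<zeta> + VY y' \<zeta> + VZ z' \<zeta>)"
      if "\<zeta> \<in> D" for \<zeta>
    proof -
      have "VX x \<zeta> = (\<zeta> - l) * VX x' \<zeta> - (s + t)"
        using x'(3)[of \<zeta>] that D by (auto simp: eq_diff_eq)
      moreover have "VY y \<zeta> = (\<zeta> - l) * VY y' \<zeta> + s" "VZ z \<zeta> = (\<zeta> - l) * VZ z' \<zeta> + t"
        using y'(4)[of \<zeta>] z'(4)[of \<zeta>] that D by auto
      ultimately show ?thesis by (simp add: distrib_left)
    qed
    ultimately show "\<exists>x' y' z'. ell2 x' \<and> ell2 y' \<and> ell2 z' \<and>
     ell2_norm x' + ell2_norm y' + ell2_norm z' \<le> K * ?N \<and>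
     (\<forall>\<zeta>\<in>D. VX x \<zeta> + VY y \<zeta> + VZ z \<zeta> = (\<zeta> - l) * (VX x' \<zeta> + VY y' \<zeta> + VZ z' \<zeta>))"
      using x'(1) y'(1) z'(1) by blast
  qed
qed

subsection \<open>Uniqueness of the expansion\<close>

lemma hole_part_holomorphic_on:
  assumes "Bseq c" "r > 0"
  shows "hole_part b r c holomorphic_on exterior_disk b r"
proof -
  have "(power_series c \<circ> (\<lambda>\<zeta>. of_real r / (\<zeta> - b))) holomorphic_on exterior_disk b r"
  proof (rule holomorphic_on_compose_gen[OF _ power_series_holomorphic_on[OF assms(1)]])
    show "(\<lambda>\<zeta>. of_real r / (\<zeta> - b)) holomorphic_on exterior_disk b r"
      using assms(2) by (intro holomorphic_intros) (auto simp: mem_exterior_disk_iff)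
    show "(\<lambda>\<zeta>. of_real r / (\<zeta> - b)) ` exterior_disk b r \<subseteq> ball 0 1"
      using assms(2) by (auto simp: mem_exterior_disk_iff norm_divide divide_less_eq)
  qed
  moreover have "(\<lambda>\<zeta>. of_real r / (\<zeta> - b)) holomorphic_on exterior_disk b r"
    using assms(2) by (intro holomorphic_intros) (auto simp: mem_exterior_disk_iff)
  ultimately show ?thesis
    unfolding hole_part_def[abs_def] by (intro holomorphic_on_mult) (simp_all add: o_def)
qed

lemma hole_part_tendsto_0:
  assumes "Bseq c"
  shows "(hole_part b r c \<longlongrightarrow> 0) at_infinity"
proof -
  have "filterlim (\<lambda>\<zeta>. - b + \<zeta>) at_infinity at_infinity"
    by (rule tendsto_add_filterlim_at_infinity[OF tendsto_const filterlim_ident])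
  then have lim: "((\<lambda>\<zeta>. of_real r / (\<zeta> - b)) \<longlongrightarrow> 0) at_infinity"
    by (intro tendsto_divide_0[OF tendsto_const]) (simp add: algebra_simps)
  have "isCont (power_series c) 0"
    using holomorphic_on_imp_continuous_on[OF power_series_holomorphic_on[OF assms]]
    by (subst (asm) continuous_on_eq_continuous_at) auto
  from isCont_tendsto_compose[OF this lim]
  have "((\<lambda>\<zeta>. power_series c (of_real r / (\<zeta> - b))) \<longlongrightarrow> power_series c 0) at_infinity" .
  from tendsto_mult[OF lim this] show ?thesis unfolding hole_part_def[abs_def] by simp
qed

text \<open>The map sending \<open>w\<close> to \<open>b + r / w\<close> inverts the change of
  variable and carries the punctured unit disk into the exterior of the hole.\<close>

lemma hole_part_eq_0_imp:
  assumes c: "Bseq c" and r: "r > 0" and z: "\<And>\<zeta>. \<zeta> \<in> exterior_disk b r \<Longrightarrow> hole_part b r c \<zeta> = 0"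
  shows "c n = 0"
proof (rule power_series_eq_0_imp[OF c])
  fix w :: complex assume w: "norm w < 1" "w \<noteq> 0"
  have "b + of_real r / w \<in> exterior_disk b r"
    using w r by (simp add: mem_exterior_disk_iff norm_divide less_divide_eq)
  from z[OF this] show "power_series c w = 0" using w r by (simp add: hole_part_def)
qed

text \<open>The two functions define one entire function vanishing at infinity, which is 0 by
  Liouville's theorem. If \<open>A\<close> is bounded, only \<open>g\<close> is seen near infinity;
  this case serves the disk, the other one the two hole exteriors.\<close>

lemma glued_entire_eq_0:
  fixes f g :: "complex \<Rightarrow> complex"
  assumes "f holomorphic_on A" "g holomorphic_on B" "open A" "open B" "A \<union> B = UNIV"
    and "\<forall>z\<in>A \<inter> B. f z = g z"
    and "(f \<longlongrightarrow> 0) at_infinity \<or> bounded A" and g: "(g \<longlongrightarrow> 0) at_infinity"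
  shows "\<forall>z\<in>A. f z = 0" "\<forall>z\<in>B. g z = 0"
proof -
  define h where "h = (\<lambda>z. if z \<in> A then f z else g z)"
  have "h holomorphic_on (A \<union> B)"
    unfolding h_def using assms by (intro holomorphic_on_If_Un) auto
  then have hol: "h holomorphic_on UNIV" using assms(5) by simp
  have "(h \<longlongrightarrow> 0) at_infinity"
  proof (cases "bounded A")
    case True
    then obtain M where "\<And>z. z \<in> A \<Longrightarrow> norm z \<le> M" by (auto simp: bounded_iff)
    then have "eventually (\<lambda>z. g z = h z) at_infinity"
      unfolding eventually_at_infinity h_def by (intro exI[of _ "M + 1"]) force
    with g show ?thesis by (rule Lim_transform_eventually)
  next
    case False
    then have "(f \<longlongrightarrow> 0) at_infinity" using assms(7) by blast
    with g show ?thesis unfolding h_def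
      by (intro filterlim_If) (auto intro: tendsto_mono[OF inf_le1])
  qed
  then have 0: "h z = 0" for z using Liouville_weak_0[OF hol] by blast
  show "\<forall>z\<in>A. f z = 0" using 0 unfolding h_def by metis
  show "\<forall>z\<in>B. g z = 0" using 0 assms(6) unfolding h_def by (metis IntI)
qed

lemma Bseq_diff:
  fixes c d :: "nat \<Rightarrow> 'a::real_normed_vector"
  assumes "Bseq c" "Bseq d"
  shows "Bseq (\<lambda>n. c n - d n)"
proof -
  obtain K L where "\<And>n. norm (c n) \<le> K" "\<And>n. norm (d n) \<le> L"
    using assms by (auto simp: Bseq_def)
  then have "norm (c n - d n) \<le> K + L" for n
    by (meson add_mono norm_triangle_ineq4 order_trans)
  then show ?thesis by (rule BseqI')
qed

lemma power_series_diff: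
  assumes "Bseq c" "Bseq d" "norm w < 1"
  shows "power_series (\<lambda>n. c n - d n) w = power_series c w - power_series d w"
  using sums_diff[OF power_series_sums[OF assms(1,3)] power_series_sums[OF assms(2,3)]]
  unfolding power_series_def by (simp add: sums_iff algebra_simps)

lemma hole_part_diff:
  assumes "Bseq c" "Bseq d" "r > 0" "\<zeta> \<in> exterior_disk b r"
  shows "hole_part b r (\<lambda>n. c n - d n) \<zeta> = hole_part b r c \<zeta> - hole_part b r d \<zeta>"
proof -
  have w: "norm (of_real r / (\<zeta> - b)) < 1"
    using assms(3,4) by (auto simp: mem_exterior_disk_iff norm_divide divide_less_eq)
  show ?thesis unfolding hole_part_def
    by (simp only: power_series_diff[OF assms(1,2) w] right_diff_distrib)
qed

lemma open_exterior_disk: "open (exterior_disk b r)"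
  by (simp add: exterior_disk_def open_Compl)

section \<open>The interior of the pair of pants and the expansion as three power series\<close>

definition pants_interior :: "real \<Rightarrow> real \<Rightarrow> real \<Rightarrow> complex set" where
  "pants_interior a r1 r2 = ball 0 1 \<inter> exterior_disk 0 r1 \<inter> exterior_disk (of_real a) r2"

definition pants_sum :: "real \<Rightarrow> real \<Rightarrow> real \<Rightarrow> (nat \<Rightarrow> complex) \<Rightarrow> (nat \<Rightarrow> complex) \<Rightarrow>
    (nat \<Rightarrow> complex) \<Rightarrow> complex \<Rightarrow> complex" where
  "pants_sum a r1 r2 e f g \<zeta> =
     power_series e \<zeta> + hole_part 0 r1 f \<zeta> + hole_part (of_real a) r2 g \<zeta>"

lemma interior_pair_of_pants:
  assumes "r1 > 0" "r2 > 0"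
  shows "interior (pair_of_pants a r1 r2) = pants_interior a r1 r2"
proof -
  have "pair_of_pants a r1 r2 = cball 0 1 \<inter> - ball 0 r1 \<inter> - ball (of_real a) r2"
    unfolding pair_of_pants_def by (auto simp: dist_norm norm_minus_commute)
  then show ?thesis
    using assms by (simp add: interior_complement pants_interior_def exterior_disk_def closure_ball)
qed

lemma bij_betw_negative_ints: "bij_betw (\<lambda>n. - 1 - int n) UNIV {..-1}"
  by (rule bij_betwI[of _ _ _ "\<lambda>k. nat (- 1 - k)"]) auto

lemma square_summable_nat_iff: "square_summable UNIV c \<longleftrightarrow> ell2 c"
  unfolding square_summable_def ell2_def by (intro summable_on_UNIV_nonneg_real_iff) auto

lemma square_summable_negative_iff:
  "square_summable {..-1} c \<longleftrightarrow> ell2 (\<lambda>n. c (- 1 - int n))"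
  using summable_on_reindex_bij_betw[OF bij_betw_negative_ints, of "\<lambda>k. (norm (c k))\<^sup>2"]
    square_summable_nat_iff[of "\<lambda>n. c (- 1 - int n)"]
  unfolding square_summable_def by simp

lemma has_sum_ell2_norm:
  assumes "ell2 c"
  shows "((\<lambda>n. (norm (c n))\<^sup>2) has_sum (ell2_norm c)\<^sup>2) UNIV"
proof -
  have s: "summable (\<lambda>n. (norm (c n))\<^sup>2)" using assms by (simp add: ell2_def)
  have "(\<lambda>n. (norm (c n))\<^sup>2) sums (\<Sum>n. (norm (c n))\<^sup>2)" using s by (rule summable_sums)
  moreover have "(\<Sum>n. (norm (c n))\<^sup>2) = (ell2_norm c)\<^sup>2"
    unfolding ell2_norm_def using s by (simp add: suminf_nonneg)
  ultimately show ?thesis using s by (intro norm_summable_imp_has_sum) auto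
qed

lemma infsum_power_series:
  assumes "Bseq c" "norm w < 1"
  shows "(\<Sum>\<^sub>\<infinity>n. c n * w ^ n) = power_series c w"
  using norm_summable_imp_has_sum[OF summable_power_series[OF assms] power_series_sums[OF assms]]
  by (rule infsumI)

lemma infsum_hole_part:
  assumes c: "Bseq (\<lambda>n. c (- 1 - int n))" and r: "r > 0" and z: "\<zeta> \<in> exterior_disk b r"
  shows "(\<Sum>\<^sub>\<infinity>k\<in>{..-1}. c k * ((\<zeta> - b) / of_real r) powi k) = hole_part b r (\<lambda>n. c (- 1 - int n)) \<zeta>"
proof -
  define w where "w = of_real r / (\<zeta> - b)"
  have w: "norm w < 1" using z r by (auto simp: w_def mem_exterior_disk_iff norm_divide divide_less_eq)
  \<comment> \<open>Exponents start at -1, so one factor \<open>w\<close> remains; it is the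
    prefactor in \<open>hole_part\<close>.\<close>
  have *: "((\<zeta> - b) / of_real r) powi (- 1 - int n) = w * w ^ n" for n
  proof -
    have "- 1 - int n = - int (Suc n)" by simp
    then have "((\<zeta> - b) / of_real r) powi (- 1 - int n) = inverse (((\<zeta> - b) / of_real r) ^ Suc n)"
      by (simp only: power_int_minus power_int_of_nat)
    also have "\<dots> = w ^ Suc n"
      by (simp only: power_inverse[symmetric] w_def inverse_divide)
    finally show ?thesis by simp
  qed
  have "(\<Sum>\<^sub>\<infinity>k\<in>{..-1}. c k * ((\<zeta> - b) / of_real r) powi k)
      = (\<Sum>\<^sub>\<infinity>n. c (- 1 - int n) * ((\<zeta> - b) / of_real r) powi (- 1 - int n))"
    by (rule infsum_reindex_bij_betw[OF bij_betw_negative_ints, symmetric])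
  also have "\<dots> = (\<Sum>\<^sub>\<infinity>n. w * (c (- 1 - int n) * w ^ n))"
    unfolding * by (simp add: mult_ac)
  also have "\<dots> = w * power_series (\<lambda>n. c (- 1 - int n)) w"
    by (subst infsum_cmult_right') (simp add: infsum_power_series[OF c w])
  finally show ?thesis unfolding hole_part_def w_def .
qed

text \<open>Together with the next lemma, this compares the sum of the three coefficient norms, in
  which division is estimated, with the Hilbert space norm.\<close>

lemma sum_le_sqrt_sum_squares:
  fixes x y z :: real
  shows "x + y + z \<le> 3 * sqrt (x\<^sup>2 + (y\<^sup>2 + z\<^sup>2))"
proof -
  have "x \<le> sqrt (x\<^sup>2 + (y\<^sup>2 + z\<^sup>2))" "y \<le> sqrt (x\<^sup>2 + (y\<^sup>2 + z\<^sup>2))" "z \<le> sqrt (x\<^sup>2 + (y\<^sup>2 + z\<^sup>2))"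
    by (intro real_le_rsqrt; simp)+
  then show ?thesis by simp
qed

lemma sqrt_sum_squares_le_sum3:
  fixes x y z :: real
  assumes "x \<ge> 0" "y \<ge> 0" "z \<ge> 0"
  shows "sqrt (x\<^sup>2 + (y\<^sup>2 + z\<^sup>2)) \<le> x + y + z"
  using assms by (intro real_le_lsqrt) (auto simp: power2_eq_square algebra_simps)

locale pants =
  fixes a r1 r2 :: real
  assumes pos: "r1 > 0" "r2 > 0" and outer: "0 < a" "a + r2 < 1" and disjoint: "r1 + r2 < a"
begin

abbreviation "U \<equiv> pants_interior a r1 r2"
abbreviation "S \<equiv> pants_sum a r1 r2"

lemma pants_sum_holomorphic_on:
  assumes "Bseq e" "Bseq f" "Bseq g"
  shows "S e f g holomorphic_on U"
proof -
  have "(\<lambda>\<zeta>. power_series e \<zeta> + hole_part 0 r1 f \<zeta> + hole_part (of_real a) r2 g \<zeta>) holomorphic_on U"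
    by (intro holomorphic_on_add holomorphic_on_subset[OF power_series_holomorphic_on[OF assms(1)]]
        holomorphic_on_subset[OF hole_part_holomorphic_on[OF assms(2) pos(1)]]
        holomorphic_on_subset[OF hole_part_holomorphic_on[OF assms(3) pos(2)]])
       (auto simp: pants_interior_def)
  then show ?thesis by (simp add: pants_sum_def[abs_def])
qed

text \<open>Bounded rather than square summable coefficients, to cover the expansions of
  \<open>1/(\<zeta> - l)\<close> for boundary points \<open>l\<close>.\<close>

lemma pants_sum_eq_0_imp:
  assumes B: "Bseq e" "Bseq f" "Bseq g" and z: "\<And>\<zeta>. \<zeta> \<in> U \<Longrightarrow> S e f g \<zeta> = 0"
  shows "e n = 0" "f n = 0" "g n = 0"
proof -
  let ?F = "hole_part 0 r1 f" and ?G = "hole_part (of_real a) r2 g"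
  let ?DF = "exterior_disk 0 r1" and ?DG = "exterior_disk (of_real a) r2 :: complex set"
  have hF: "?F holomorphic_on ?DF" and hG: "?G holomorphic_on ?DG"
    using B pos by (auto intro: hole_part_holomorphic_on)
  \<comment> \<open>Both closed holes lie in the open unit disk, so the disk and the common exterior
    of the holes cover the plane.\<close>
  have sub: "- ball 0 1 \<subseteq> ?DF \<inter> ?DG"
  proof
    fix \<zeta> :: complex assume "\<zeta> \<in> - ball 0 1"
    then have "norm \<zeta> \<ge> 1" by simp
    moreover have "norm \<zeta> \<le> norm (\<zeta> - of_real a) + a"
      using norm_triangle_ineq[of "\<zeta> - of_real a" "of_real a"] outer by simp
    ultimately show "\<zeta> \<in> ?DF \<inter> ?DG" using outer disjoint pos by (auto simp: mem_exterior_disk_iff)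
  qed
  \<comment> \<open>The closed holes are disjoint, by \<open>r1 + r2 < a\<close>.\<close>
  have un: "?DF \<union> ?DG = UNIV"
  proof -
    have "\<zeta> \<in> ?DF" if "\<zeta> \<notin> ?DG" for \<zeta> :: complex
    proof -
      have "a \<le> norm (\<zeta> - of_real a) + norm \<zeta>"
        using norm_triangle_ineq4[of \<zeta> "\<zeta> - of_real a"] outer by simp
      with that disjoint show ?thesis by (auto simp: mem_exterior_disk_iff)
    qed
    then show ?thesis by blast
  qed
  let ?H = "\<lambda>\<zeta>. - (?F \<zeta> + ?G \<zeta>)"
  have limF: "(?F \<longlongrightarrow> 0) at_infinity" and limG: "(?G \<longlongrightarrow> 0) at_infinity"
    using B by (auto intro: hole_part_tendsto_0)
  have H0: "(?H \<longlongrightarrow> 0) at_infinity"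
    using tendsto_minus[OF tendsto_add[OF limF limG]] by simp
  have hH: "?H holomorphic_on ?DF \<inter> ?DG"
    using hF hG by (intro holomorphic_intros) (auto intro: holomorphic_on_subset)
  have eqH: "\<forall>\<zeta>\<in>ball 0 1 \<inter> (?DF \<inter> ?DG). power_series e \<zeta> = ?H \<zeta>"
    using z by (auto simp: pants_interior_def pants_sum_def add_eq_0_iff2 add.assoc)
  have un1: "ball 0 1 \<union> (?DF \<inter> ?DG) = UNIV" using sub by blast
  \<comment> \<open>The first gluing separates the disk part from the sum of the hole parts; both
    vanish on their full domains.\<close>
  note glue1 = glued_entire_eq_0[OF power_series_holomorphic_on[OF B(1)] hH open_ball
      open_Int[OF open_exterior_disk open_exterior_disk] un1 eqH disjI2[OF bounded_ball] H0]
  show "e n = 0"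
    using glue1(1) by (intro power_series_eq_0_imp[OF B(1)]) auto
  have hG': "(\<lambda>\<zeta>. - ?G \<zeta>) holomorphic_on ?DG" using hG by (intro holomorphic_intros)
  have G0: "((\<lambda>\<zeta>. - ?G \<zeta>) \<longlongrightarrow> 0) at_infinity" using tendsto_minus[OF limG] by simp
  have eqG: "\<forall>\<zeta>\<in>?DF \<inter> ?DG. ?F \<zeta> = - ?G \<zeta>"
    using glue1(2) by (simp only: neg_equal_0_iff_equal eq_neg_iff_add_eq_0)
  \<comment> \<open>The second gluing separates the two hole parts, which are now known to cancel on
    all of \<open>?DF \<inter> ?DG\<close> and not only on \<open>U\<close>.\<close>
  note glue2 = glued_entire_eq_0[OF hF hG' open_exterior_disk open_exterior_disk un eqG disjI1[OF limF] G0]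
  show "f n = 0" using glue2(1) by (intro hole_part_eq_0_imp[OF B(2) pos(1), of 0]) blast
  show "g n = 0" using glue2(2)[unfolded neg_equal_0_iff_equal] by (intro hole_part_eq_0_imp[OF B(3) pos(2), of "of_real a"]) blast
qed

lemma pants_sum_unique:
  assumes B: "Bseq e" "Bseq f" "Bseq g" and B': "Bseq e'" "Bseq f'" "Bseq g'"
    and eq: "\<And>\<zeta>. \<zeta> \<in> U \<Longrightarrow> S e f g \<zeta> = S e' f' g' \<zeta>"
  shows "e = e'" "f = f'" "g = g'"
proof -
  have z: "S (\<lambda>n. e n - e' n) (\<lambda>n. f n - f' n) (\<lambda>n. g n - g' n) \<zeta> = 0" if u: "\<zeta> \<in> U" for \<zeta>
  proof -
    have u': "norm \<zeta> < 1" "\<zeta> \<in> exterior_disk 0 r1" "\<zeta> \<in> exterior_disk (of_real a) r2"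
      using u by (auto simp: pants_interior_def)
    have "S (\<lambda>n. e n - e' n) (\<lambda>n. f n - f' n) (\<lambda>n. g n - g' n) \<zeta> = S e f g \<zeta> - S e' f' g' \<zeta>"
      unfolding pants_sum_def power_series_diff[OF B(1) B'(1) u'(1)]
        hole_part_diff[OF B(2) B'(2) pos(1) u'(2)] hole_part_diff[OF B(3) B'(3) pos(2) u'(3)]
      by (simp add: algebra_simps)
    then show ?thesis using eq[OF u] by simp
  qed
  note zz = pants_sum_eq_0_imp[OF Bseq_diff[OF B(1) B'(1)] Bseq_diff[OF B(2) B'(2)] Bseq_diff[OF B(3) B'(3)] z]
  show "e = e'" using zz(1) by (auto simp: fun_eq_iff)
  show "f = f'" using zz(2) by (auto simp: fun_eq_iff)
  show "g = g'" using zz(3) by (auto simp: fun_eq_iff)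
qed

subsection \<open>The space in coefficients, and the spectrum\<close>

lemma interior_eq: "interior (pair_of_pants a r1 r2) = U"
  by (rule interior_pair_of_pants[OF pos])

lemma pants_expansion_iff:
  "pants_expansion a r1 r2 \<phi> e f g \<longleftrightarrow>
     ell2 e \<and> ell2 (\<lambda>n. f (- 1 - int n)) \<and> ell2 (\<lambda>n. g (- 1 - int n)) \<and>
     (\<forall>\<zeta>\<in>U. \<phi> \<zeta> = S e (\<lambda>n. f (- 1 - int n)) (\<lambda>n. g (- 1 - int n)) \<zeta>)"
proof -
  have "(\<Sum>\<^sub>\<infinity>n. e n * pants_E n \<zeta>) + (\<Sum>\<^sub>\<infinity>n\<in>{..-1}. f n * pants_F r1 n \<zeta>)
      + (\<Sum>\<^sub>\<infinity>n\<in>{..-1}. g n * pants_G a r2 n \<zeta>)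
      = S e (\<lambda>n. f (- 1 - int n)) (\<lambda>n. g (- 1 - int n)) \<zeta>"
    if "ell2 e" "ell2 (\<lambda>n. f (- 1 - int n))" "ell2 (\<lambda>n. g (- 1 - int n))" "\<zeta> \<in> U" for \<zeta>
    unfolding pants_sum_def pants_E_def pants_F_def pants_G_def
    using that pos infsum_power_series[of e \<zeta>] infsum_hole_part[of f r1 \<zeta> 0]
      infsum_hole_part[of g r2 \<zeta> "of_real a"]
    by (simp add: ell2_imp_Bseq pants_interior_def)
  then show ?thesis
    unfolding pants_expansion_def interior_eq square_summable_nat_iff square_summable_negative_iff
    by auto
qed

definition pants_fun :: "(nat \<Rightarrow> complex) \<Rightarrow> (nat \<Rightarrow> complex) \<Rightarrow> (nat \<Rightarrow> complex) \<Rightarrow> complex \<Rightarrow> complex" where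
  "pants_fun e f g = (\<lambda>\<zeta>. if \<zeta> \<in> U then S e f g \<zeta> else 0)"

text \<open>On negative \<open>k\<close>, \<open>nat (- 1 - k)\<close> inverts the indexing by
  \<open>- 1 - int n\<close>. At nonnegative \<open>k\<close> it takes the default value 0, where
  the coefficients are irrelevant.\<close>

lemma pants_fun_expansion:
  assumes "ell2 e" "ell2 f" "ell2 g"
  shows "pants_expansion a r1 r2 (pants_fun e f g) e (\<lambda>k. f (nat (- 1 - k))) (\<lambda>k. g (nat (- 1 - k)))"
  using assms by (simp add: pants_expansion_iff pants_fun_def)

lemma pants_space_eq:
  "pants_space a r1 r2 = {pants_fun e f g | e f g. ell2 e \<and> ell2 f \<and> ell2 g}"
proof (intro equalityI subsetI)
  fix \<phi> assume "\<phi> \<in> pants_space a r1 r2"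
  then obtain e f g where x: "pants_expansion a r1 r2 \<phi> e f g" and 0: "\<And>\<zeta>. \<zeta> \<notin> U \<Longrightarrow> \<phi> \<zeta> = 0"
    unfolding pants_space_def interior_eq by blast
  have "\<phi> = pants_fun e (\<lambda>n. f (- 1 - int n)) (\<lambda>n. g (- 1 - int n))"
    using x 0 by (auto simp: pants_expansion_iff pants_fun_def)
  then show "\<phi> \<in> {pants_fun e f g | e f g. ell2 e \<and> ell2 f \<and> ell2 g}"
    using x by (auto simp: pants_expansion_iff)
next
  fix \<phi> assume "\<phi> \<in> {pants_fun e f g | e f g. ell2 e \<and> ell2 f \<and> ell2 g}"
  then obtain e f g where l: "ell2 e" "ell2 f" "ell2 g" and \<phi>: "\<phi> = pants_fun e f g" by blast
  have "S e f g holomorphic_on U" using l by (intro pants_sum_holomorphic_on ell2_imp_Bseq)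
  then have "\<phi> holomorphic_on U"
    by (rule holomorphic_transform) (simp add: \<phi> pants_fun_def)
  moreover have "\<phi> \<zeta> = 0" if "\<zeta> \<notin> U" for \<zeta> using that by (simp add: \<phi> pants_fun_def)
  ultimately show "\<phi> \<in> pants_space a r1 r2"
    unfolding pants_space_def interior_eq using pants_fun_expansion[OF l] \<phi> by blast
qed

lemma infsum_norms_eq:
  assumes "ell2 (\<lambda>n. f (- 1 - int n))" "ell2 (\<lambda>n. g (- 1 - int n))"
  shows "(\<Sum>\<^sub>\<infinity>n\<in>{..-1}. (norm (f n))\<^sup>2 + (norm (g n))\<^sup>2) =
    (ell2_norm (\<lambda>n. f (- 1 - int n)))\<^sup>2 + (ell2_norm (\<lambda>n. g (- 1 - int n)))\<^sup>2"
  using infsumI[OF has_sum_add[OF has_sum_ell2_norm[OF assms(1)] has_sum_ell2_norm[OF assms(2)]]]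
    infsum_reindex_bij_betw[OF bij_betw_negative_ints, of "\<lambda>n. (norm (f n))\<^sup>2 + (norm (g n))\<^sup>2"]
  by simp

text \<open>The definite description is resolved by \<open>pants_sum_unique\<close>: any other
  expansion has the same coefficients at the relevant indices, hence the same norm.\<close>

lemma pants_norm_eq:
  assumes l: "ell2 e" "ell2 f" "ell2 g"
  shows "pants_norm a r1 r2 (pants_fun e f g) =
    sqrt ((ell2_norm e)\<^sup>2 + ((ell2_norm f)\<^sup>2 + (ell2_norm g)\<^sup>2))"
  unfolding pants_norm_def
proof (rule the_equality)
  let ?f = "\<lambda>k::int. f (nat (- 1 - k))" and ?g = "\<lambda>k::int. g (nat (- 1 - k))"
  show "\<exists>e' f' g'. pants_expansion a r1 r2 (pants_fun e f g) e' f' g' \<and>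
     sqrt ((ell2_norm e)\<^sup>2 + ((ell2_norm f)\<^sup>2 + (ell2_norm g)\<^sup>2)) =
     sqrt ((\<Sum>\<^sub>\<infinity>n. (norm (e' n))\<^sup>2) + (\<Sum>\<^sub>\<infinity>n\<in>{..-1}. (norm (f' n))\<^sup>2 + (norm (g' n))\<^sup>2))"
    using pants_fun_expansion[OF l] infsumI[OF has_sum_ell2_norm[OF l(1)]] infsum_norms_eq[of ?f ?g] l
    by (intro exI[of _ e] exI[of _ ?f] exI[of _ ?g]) simp
next
  fix N
  assume "\<exists>e' f' g'. pants_expansion a r1 r2 (pants_fun e f g) e' f' g' \<and>
     N = sqrt ((\<Sum>\<^sub>\<infinity>n. (norm (e' n))\<^sup>2) + (\<Sum>\<^sub>\<infinity>n\<in>{..-1}. (norm (f' n))\<^sup>2 + (norm (g' n))\<^sup>2))"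
  then obtain e' f' g' where x: "pants_expansion a r1 r2 (pants_fun e f g) e' f' g'"
    and N: "N = sqrt ((\<Sum>\<^sub>\<infinity>n. (norm (e' n))\<^sup>2) + (\<Sum>\<^sub>\<infinity>n\<in>{..-1}. (norm (f' n))\<^sup>2 + (norm (g' n))\<^sup>2))"
    by blast
  let ?f' = "\<lambda>n. f' (- 1 - int n)" and ?g' = "\<lambda>n. g' (- 1 - int n)"
  have l': "ell2 e'" "ell2 ?f'" "ell2 ?g'" using x by (auto simp: pants_expansion_iff)
  have eq: "S e f g \<zeta> = S e' ?f' ?g' \<zeta>" if "\<zeta> \<in> U" for \<zeta>
    using x that by (auto simp: pants_expansion_iff pants_fun_def)
  note u = pants_sum_unique[OF l[THEN ell2_imp_Bseq] l'[THEN ell2_imp_Bseq] eq]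
  show "N = sqrt ((ell2_norm e)\<^sup>2 + ((ell2_norm f)\<^sup>2 + (ell2_norm g)\<^sup>2))"
    unfolding N infsumI[OF has_sum_ell2_norm[OF l'(1)]] infsum_norms_eq[OF l'(2,3)] using u by simp
qed

section \<open>The resolvent at points outside the pair of pants\<close>

lemma divisible_pants_sum:
  assumes l: "l \<notin> pair_of_pants a r1 r2"
  shows "divisible_sums power_series (hole_part 0 r1) (hole_part (of_real a) r2) U l"
proof -
  let ?E = "power_series" and ?F = "hole_part 0 r1" and ?G = "hole_part (of_real a) r2"
  let ?DE = "ball 0 1" and ?DF = "exterior_disk 0 r1" and ?DG = "exterior_disk (of_real a) r2"
  have t1: "norm l \<le> norm (l - of_real a) + a"
    using norm_triangle_ineq[of "l - of_real a" "of_real a"] outer by simp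
  have t2: "a \<le> norm (l - of_real a) + norm l"
    using norm_triangle_ineq4[of l "l - of_real a"] outer by simp
  have E: "splits_off_pole ?E ?DE l" if "norm l < 1"
    using disk_splits_off_pole[OF that] .
  have F: "splits_off_pole ?F ?DF l" if "norm l > r1"
    using that pos by (intro hole_splits_off_pole) (auto simp: mem_exterior_disk_iff)
  have G: "splits_off_pole ?G ?DG l" if "norm (l - of_real a) > r2"
    using that pos by (intro hole_splits_off_pole) (auto simp: mem_exterior_disk_iff)
  \<comment> \<open>In each case the named piece absorbs the pole, and \<open>t1\<close>,
    \<open>t2\<close> place \<open>l\<close> in the domains of the other two pieces.\<close>
  consider "norm l > 1" | "norm l < r1" | "norm (l - of_real a) < r2"
    using l by (auto simp: pair_of_pants_def)
  then show ?thesis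
  proof cases
    case 1
    have "absorbs_pole ?E ?DE l" using 1 by (rule disk_absorbs_pole)
    moreover have "splits_off_pole ?F ?DF l" "splits_off_pole ?G ?DG l"
      using 1 t1 outer disjoint pos by (intro F G; linarith)+
    ultimately show ?thesis by (rule divisible_sumsI) (auto simp: pants_interior_def)
  next
    case 2
    have "absorbs_pole ?F ?DF l" using 2 by (intro hole_absorbs_pole) simp
    moreover have "splits_off_pole ?G ?DG l" "splits_off_pole ?E ?DE l"
      using 2 t2 outer disjoint pos by (intro G E; linarith)+
    ultimately have "divisible_sums ?F ?G ?E U l"
      by (rule divisible_sumsI) (auto simp: pants_interior_def)
    then show ?thesis by (rule divisible_sums_rotate[OF divisible_sums_rotate])
  next
    case 3
    have "absorbs_pole ?G ?DG l" using 3 by (rule hole_absorbs_pole)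
    moreover have "splits_off_pole ?E ?DE l" "splits_off_pole ?F ?DF l"
      using 3 t1 t2 outer disjoint pos by (intro E F; linarith)+
    ultimately have "divisible_sums ?G ?E ?F U l"
      by (rule divisible_sumsI) (auto simp: pants_interior_def)
    then show ?thesis by (rule divisible_sums_rotate)
  qed
qed

lemma resolvent_outside_pants:
  assumes l: "l \<notin> pair_of_pants a r1 r2"
  shows "l \<notin> operator_spectrum (pants_space a r1 r2) (pants_norm a r1 r2) mult_coord"
proof -
  let ?H = "pants_space a r1 r2" and ?N = "pants_norm a r1 r2"
  define R :: "(complex \<Rightarrow> complex) \<Rightarrow> complex \<Rightarrow> complex" where "R \<phi> = (\<lambda>\<zeta>. \<phi> \<zeta> / (\<zeta> - l))" for \<phi>
  have lU: "l \<notin> U"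
    using l interior_subset[of "pair_of_pants a r1 r2"] by (auto simp: interior_eq)
  obtain K where K: "K \<ge> 0" and div: "\<And>e f g. ell2 e \<Longrightarrow> ell2 f \<Longrightarrow> ell2 g \<Longrightarrow> \<exists>e' f' g'.
     ell2 e' \<and> ell2 f' \<and> ell2 g' \<and>
     ell2_norm e' + ell2_norm f' + ell2_norm g' \<le> K * (ell2_norm e + ell2_norm f + ell2_norm g) \<and>
     (\<forall>\<zeta>\<in>U. S e f g \<zeta> = (\<zeta> - l) * S e' f' g' \<zeta>)"
    using divisible_pants_sum[OF l] unfolding divisible_sums_def pants_sum_def by blast
  have R: "R \<phi> \<in> ?H \<and> ?N (R \<phi>) \<le> (K * 3) * ?N \<phi>" if "\<phi> \<in> ?H" for \<phi>
  proof -
    obtain e f g where c: "ell2 e" "ell2 f" "ell2 g" and \<phi>: "\<phi> = pants_fun e f g"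
      using \<open>\<phi> \<in> ?H\<close> unfolding pants_space_eq by blast
    obtain e' f' g' where c': "ell2 e'" "ell2 f'" "ell2 g'"
      and b: "ell2_norm e' + ell2_norm f' + ell2_norm g' \<le> K * (ell2_norm e + ell2_norm f + ell2_norm g)"
      and eq: "\<And>\<zeta>. \<zeta> \<in> U \<Longrightarrow> S e f g \<zeta> = (\<zeta> - l) * S e' f' g' \<zeta>"
      using div[OF c] by blast
    \<comment> \<open>Inside \<open>U\<close> the denominator is nonzero because \<open>l\<close> is
      not in \<open>U\<close>; outside, both sides are 0.\<close>
    have Re: "R \<phi> = pants_fun e' f' g'"
      using eq lU by (auto simp: R_def \<phi> pants_fun_def fun_eq_iff)
    have "?N (R \<phi>) \<le> ell2_norm e' + ell2_norm f' + ell2_norm g'"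
      unfolding Re pants_norm_eq[OF c'] using c'
      by (intro sqrt_sum_squares_le_sum3 ell2_norm_nonneg)
    also have "\<dots> \<le> K * (ell2_norm e + ell2_norm f + ell2_norm g)" by (rule b)
    also have "\<dots> \<le> K * (3 * ?N \<phi>)"
      unfolding \<phi> pants_norm_eq[OF c] using K by (intro mult_left_mono sum_le_sqrt_sum_squares)
    finally show ?thesis using c' Re by (auto simp: pants_space_eq mult.assoc)
  qed
  have "bounded_operator_on ?H ?N R"
    unfolding bounded_operator_on_def
  proof (intro conjI)
    show "\<exists>C. \<forall>\<phi>\<in>?H. ?N (R \<phi>) \<le> C * ?N \<phi>" using R by blast
  qed (use R in \<open>auto simp: R_def add_divide_distrib\<close>)
  moreover have inv: "R (\<lambda>x. mult_coord \<phi> x - l * \<phi> x) = \<phi> \<and> (\<lambda>x. mult_coord (R \<phi>) x - l * R \<phi> x) = \<phi>"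
    if "\<phi> \<in> ?H" for \<phi>
  proof -
    \<comment> \<open>Division by zero yields 0, so the two inverse identities at \<zeta> = l
      require exactly this value.\<close>
    have l0: "\<phi> l = 0" using that lU by (auto simp: pants_space_eq pants_fun_def)
    have "(\<zeta> * \<phi> \<zeta> - l * \<phi> \<zeta>) / (\<zeta> - l) = \<phi> \<zeta>"
      and "\<zeta> * (\<phi> \<zeta> / (\<zeta> - l)) - l * (\<phi> \<zeta> / (\<zeta> - l)) = \<phi> \<zeta>" for \<zeta>
      unfolding left_diff_distrib[symmetric] using l0 by (cases "\<zeta> = l"; simp)+
    then show ?thesis by (simp add: R_def mult_coord_def)
  qed
  ultimately show ?thesis unfolding operator_spectrum_def by blast
qed

section \<open>Points of the pair of pants belong to the spectrum\<close>

lemma boundary_pole_not_in_pants_space: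
  assumes B: "Bseq e" "Bseq f" "Bseq g" and n: "\<not> (ell2 e \<and> ell2 f \<and> ell2 g)"
    and p: "\<And>\<zeta>. \<zeta> \<in> U \<Longrightarrow> (\<zeta> - l) * S e f g \<zeta> = 1"
    and \<psi>: "\<psi> \<in> pants_space a r1 r2" "\<And>\<zeta>. \<zeta> \<in> U \<Longrightarrow> (\<zeta> - l) * \<psi> \<zeta> = 1"
  shows False
proof -
  obtain e' f' g' where c': "ell2 e'" "ell2 f'" "ell2 g'" and eq: "\<psi> = pants_fun e' f' g'"
    using \<psi>(1) unfolding pants_space_eq by blast
  \<comment> \<open>Both sides equal 1/(\<zeta> - l) on \<open>U\<close>. Uniqueness among bounded
    coefficients then forces the given ones to be square summable.\<close>
  have "S e f g \<zeta> = S e' f' g' \<zeta>" if "\<zeta> \<in> U" for \<zeta>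
  proof -
    have "(\<zeta> - l) * S e f g \<zeta> = (\<zeta> - l) * S e' f' g' \<zeta>" "\<zeta> - l \<noteq> 0"
      using p[OF that] \<psi>(2)[OF that] that by (auto simp: eq pants_fun_def)
    then show ?thesis by simp
  qed
  from pants_sum_unique[OF B c'[THEN ell2_imp_Bseq] this] c' n show False by simp
qed

text \<open>A right inverse of z - l would send the constant 1 to a function in the space that
  equals 1/(\<zeta> - l) on the interior.\<close>

lemma pants_subset_spectrum:
  assumes l: "l \<in> pair_of_pants a r1 r2"
  shows "l \<in> operator_spectrum (pants_space a r1 r2) (pants_norm a r1 r2) mult_coord"
proof (rule ccontr)
  let ?H = "pants_space a r1 r2" and ?o = "\<lambda>_::nat. 0 :: complex"
  have B0: "Bseq ?o" and e0: "ell2 ?o" by (auto simp: ell2_def)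
  assume "\<not> ?thesis"
  then obtain R where R: "bounded_operator_on ?H (pants_norm a r1 r2) R"
    "\<And>\<phi>. \<phi> \<in> ?H \<Longrightarrow> (\<lambda>x. mult_coord (R \<phi>) x - l * R \<phi> x) = \<phi>"
    unfolding operator_spectrum_def by blast
  let ?one = "pants_fun (\<lambda>n. if n = 0 then 1 else 0) ?o ?o"
  have one: "?one \<in> ?H" using ell2_single(1)[of 1] e0 by (auto simp: pants_space_eq)
  have one1: "?one \<zeta> = 1" if "\<zeta> \<in> U" for \<zeta>
    using that suminf_finite[of "{0::nat}" "\<lambda>n. (if n = 0 then 1 else 0) * \<zeta> ^ n"]
    by (simp add: pants_fun_def pants_sum_def power_series_def hole_part_def)
  define \<psi> where "\<psi> = R ?one"
  have \<psi>: "\<psi> \<in> ?H" using R(1) one unfolding bounded_operator_on_def \<psi>_def by blast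
  have \<psi>1: "(\<zeta> - l) * \<psi> \<zeta> = 1" if "\<zeta> \<in> U" for \<zeta>
    using fun_cong[OF R(2)[OF one], of \<zeta>] one1[OF that]
    by (simp add: \<psi>_def mult_coord_def algebra_simps)
  \<comment> \<open>At \<zeta> = l the identity would read 0 = 1. Hence \<open>l\<close> lies on one
    of the three boundary circles, where the expansion of the pole is not square summable.\<close>
  have "l \<notin> U" using \<psi>1[of l] by auto
  then consider "norm l = 1" | "norm l = r1" | "norm (l - of_real a) = r2"
    using l by (force simp: pair_of_pants_def pants_interior_def mem_exterior_disk_iff)
  then show False
  proof cases
    case 1
    then obtain c where c: "Bseq c" "\<not> ell2 c" "\<And>\<zeta>. \<zeta> \<in> ball 0 1 \<Longrightarrow> (\<zeta> - l) * power_series c \<zeta> = 1"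
      using disk_boundary_pole by blast
    show False
      by (rule boundary_pole_not_in_pants_space[OF c(1) B0 B0 _ _ \<psi> \<psi>1])
        (use c in \<open>auto simp: pants_interior_def pants_sum_def\<close>)
  next
    case 2
    then obtain c where c: "Bseq c" "\<not> ell2 c" "\<And>\<zeta>. \<zeta> \<in> exterior_disk 0 r1 \<Longrightarrow> (\<zeta> - l) * hole_part 0 r1 c \<zeta> = 1"
      using hole_boundary_pole[of l 0 r1] pos by auto
    show False
      by (rule boundary_pole_not_in_pants_space[OF B0 c(1) B0 _ _ \<psi> \<psi>1])
        (use c in \<open>auto simp: pants_interior_def pants_sum_def\<close>)
  next
    case 3
    then obtain c where c: "Bseq c" "\<not> ell2 c"
      "\<And>\<zeta>. \<zeta> \<in> exterior_disk (of_real a) r2 \<Longrightarrow> (\<zeta> - l) * hole_part (of_real a) r2 c \<zeta> = 1"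
      using hole_boundary_pole[of l "of_real a" r2] pos by auto
    show False
      by (rule boundary_pole_not_in_pants_space[OF B0 B0 c(1) _ _ \<psi> \<psi>1])
        (use c in \<open>auto simp: pants_interior_def pants_sum_def\<close>)
  qed
qed

end

theorem theorem3p8:
  fixes a r1 r2 :: real
  assumes "r1 > 0" and "r2 > 0" and "0 < a" and "a < 1"
    and "a + r2 < 1" and "r1 + r2 < a"
  shows "operator_spectrum (pants_space a r1 r2) (pants_norm a r1 r2) mult_coord
         = pair_of_pants a r1 r2"
proof -
  interpret pants a r1 r2 using assms by unfold_locales
  show ?thesis using resolvent_outside_pants pants_subset_spectrum by blast
qed

end
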